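(* Let $d\ge 2$, and let $(\Omega_T)_{T\ge1}$ be the sequence of point sets in $S^d$ where $\Omega_T$ consists of all rational points on $S^d$ of height at most $T$. Then $$K((\Omega_T))=2\qquad\text{and}\qquad K_\mu((\Omega_T))=1 .$$
   Context: $S^d\subset\mathbf{R}^{d+1}$ is the unit sphere and $\mu$ its normalized (total mass 1) rotation-invariant surface measure. For $\alpha\in S^d$ and $R>0$, $C_R(\alpha)=\{x\in S^d:|x-\alpha|<R\}$ (Euclidean distance); $\mu(C_R)$ denotes $\mu(C_R(\alpha))$, which does not depend on $\alpha$. The height of a rational point of $S^d$ is its smallest common denominator: the point has height $n$ if it is $n^{-1}m$ with $m\in\mathbf{Z}^{d+1}$, $n\ge1$ and $\gcd(m_1,\dots,m_{d+1},n)=1$. Covering radius: for a finite nonempty set $X\subset S^d$, $R(X)$ is the least radius $R$ such that $S^d=\bigcup_{x\in X}\overline{C_R(x)}$. Covering exponent: for a sequence $(X_N)_N$ of finite point sets in $S^d$, $$K((X_N))=-\liminf_{N\to\infty}\frac{\log|X_N|}{\log\mu(C_{R(X_N)})}.$$ Generic covering exponent: $$K_\mu((X_N))=\inf_{(R_N)_N}\Big(-\liminf_{N\to\infty}\frac{\log|X_N|}{\log\mu(C_{R_N})}\Big),$$ where the infimum is over all sequences of radii $(R_N)_N$, $0<R_N<2$, such that $\mu\big(S^d\setminus\bigcup_{x\in X_N}C_{R_N}(x)\big)\to0$ as $N\to\infty$. *)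

theory Defs
  imports "HOL-Analysis.Analysis"
begin

text \<open>The sphere of dimension \<open>d\<close> is the set \<open>sphere 0 1\<close> in \<open>real^'n\<close> with
  \<open>CARD('n) = d + 1\<close>.\<close>

section \<open>The normalized surface measure\<close>

text \<open>The normalized surface measure is obtained by projecting the uniform distribution on the unit
  ball radially to the sphere. It is a measure on the Borel sets of the whole space, concentrated on
  the sphere; it has total mass 1 and is invariant under orthogonal transformations, as shown
  below. (The centre of the ball, whose image is not on the sphere, is a null set.)\<close>

definition sphere_measure :: "(real^'n) measure" where
  "sphere_measure = distr (uniform_measure lborel (ball 0 1)) borel (\<lambda>x. x /\<^sub>R norm x)"

definition cap :: "real \<Rightarrow> real^'n \<Rightarrow> (real^'n) set" where
  "cap R \<alpha> = {x \<in> sphere 0 1. norm (x - \<alpha>) < R}"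

text \<open>The mass of a cap of radius \<open>R\<close>. The choice of its centre on the sphere is irrelevant, see
  \<open>measure_cap\<close> below.\<close>

definition cap_mass :: "'n::finite itself \<Rightarrow> real \<Rightarrow> real" where
  "cap_mass (_ :: 'n itself) R =
     measure sphere_measure (cap R (SOME \<alpha> :: real^'n. \<alpha> \<in> sphere 0 1))"

section \<open>Covering exponents\<close>

definition covering_radius :: "(real^'n) set \<Rightarrow> real" where
  "covering_radius X = (LEAST R. 0 < R \<and> sphere 0 1 = (\<Union>x\<in>X. closure (cap R x)))"

definition covering_exponent :: "(nat \<Rightarrow> (real^'n) set) \<Rightarrow> ereal" where
  "covering_exponent X =
     - liminf (\<lambda>N. ereal (ln (real (card (X N))) / ln (cap_mass TYPE('n) (covering_radius (X N)))))"

definition generic_covering_exponent :: "(nat \<Rightarrow> (real^'n) set) \<Rightarrow> ereal" where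
  "generic_covering_exponent X =
     (INF R \<in> {R :: nat \<Rightarrow> real. (\<forall>N. 0 < R N \<and> R N < 2) \<and>
          (\<lambda>N. measure sphere_measure (sphere 0 1 - (\<Union>x\<in>X N. cap (R N) x))) \<longlonglongrightarrow> 0}.
        - liminf (\<lambda>N. ereal (ln (real (card (X N))) / ln (cap_mass TYPE('n) (R N)))))"

section \<open>Rational points\<close>

definition has_height :: "real^'n \<Rightarrow> nat \<Rightarrow> bool" where
  "has_height x n \<longleftrightarrow> n \<ge> 1 \<and>
     (\<exists>m :: int^'n. (\<forall>i. x $ i = of_int (m $ i) / of_nat n) \<and>
        Gcd (insert (int n) (range (\<lambda>i. m $ i))) = 1)"

text \<open>The sequence is indexed by all natural numbers; the member with index 0 is empty and does not
  affect the covering exponents.\<close>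

definition rational_points :: "nat \<Rightarrow> (real^'n) set" where
  "rational_points T = {x \<in> sphere 0 1. \<exists>n\<le>T. has_height x n}"

section \<open>Adequacy of the definitions\<close>

lemma radial_projection_measurable [measurable]:
  "(\<lambda>x :: real^'n. x /\<^sub>R norm x) \<in> borel_measurable borel"
  by measurable

lemma sets_sphere_measure [simp, measurable_cong]: "sets sphere_measure = sets borel"
  by (simp add: sphere_measure_def)

lemma space_sphere_measure [simp]: "space sphere_measure = UNIV"
  by (simp add: sphere_measure_def)

lemma emeasure_unit_ball:
  "emeasure lborel (ball (0::real^'n) 1) \<noteq> 0" "emeasure lborel (ball (0::real^'n) 1) \<noteq> \<infinity>"
proof -
  have "emeasure lebesgue (ball (0::real^'n) 1) \<noteq> 0"
    using negligible_iff_emeasure0[of "ball (0::real^'n) 1"] open_not_negligible[of "ball (0::real^'n) 1"] by auto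
  then show "emeasure lborel (ball (0::real^'n) 1) \<noteq> 0" by simp
  show "emeasure lborel (ball (0::real^'n) 1) \<noteq> \<infinity>"
    using emeasure_bounded_finite[OF bounded_ball[of "0::real^'n" 1]] by auto
qed

lemma emeasure_sphere_measure:
  assumes A: "A \<in> sets borel"
  shows "emeasure sphere_measure (A :: (real^'n) set) =
    emeasure lborel {x \<in> ball 0 1. x /\<^sub>R norm x \<in> A} / emeasure lborel (ball (0::real^'n) 1)"
proof -
  have m: "(\<lambda>x::real^'n. x /\<^sub>R norm x) \<in> uniform_measure lborel (ball 0 1) \<rightarrow>\<^sub>M borel"
    by (simp add: measurable_def[of "uniform_measure _ _"] space_borel[symmetric]
        del: space_borel) (use radial_projection_measurable in \<open>auto simp: measurable_def\<close>)
  have "(\<lambda>x::real^'n. x /\<^sub>R norm x) -` A \<in> sets lborel"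
    using measurable_sets[OF radial_projection_measurable A] by simp
  then show ?thesis
    unfolding sphere_measure_def by (simp add: emeasure_distr[OF m A] Int_def vimage_def)
qed

lemma emeasure_sphere_measure_sphere: "emeasure sphere_measure (sphere (0::real^'n) 1) = 1"
proof -
  have "{x \<in> ball 0 1. x /\<^sub>R norm x \<in> sphere (0::real^'n) 1} = ball 0 1 - {0}"
    by auto
  moreover have "emeasure lborel (ball (0::real^'n) 1 - {0}) = emeasure lborel (ball (0::real^'n) 1)"
    by (rule emeasure_Diff_null_set) (auto simp: null_sets_def)
  ultimately show ?thesis
    using emeasure_unit_ball[where 'n='n]
    by (simp add: emeasure_sphere_measure ennreal_divide_self less_top[symmetric])
qed

lemma prob_sphere_measure: "emeasure sphere_measure (UNIV :: (real^'n) set) = 1"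
  using emeasure_unit_ball[where 'n='n] emeasure_sphere_measure[of "UNIV :: (real^'n) set"]
    ball_def[of "0::real^'n" 1]
  by (simp add: ennreal_divide_self less_top[symmetric])

lemma nn_integral_lborel_translate:
  fixes g :: "real^'n \<Rightarrow> ennreal"
  assumes [measurable]: "g \<in> borel_measurable borel"
  shows "(\<integral>\<^sup>+x. g (a + x) \<partial>lborel) = (\<integral>\<^sup>+x. g x \<partial>lborel)"
proof -
  have "(\<integral>\<^sup>+x. g x \<partial>lborel) = (\<integral>\<^sup>+x. g x \<partial>(distr lborel borel ((+) a)))"
    by (simp add: lborel_distr_plus)
  also have "\<dots> = (\<integral>\<^sup>+x. g (a + x) \<partial>lborel)"
    by (subst nn_integral_distr) auto
  finally show ?thesis ..
qed

lemma nn_integral_lborel_reflect: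
  fixes g :: "real^'n \<Rightarrow> ennreal"
  assumes [measurable]: "g \<in> borel_measurable borel"
  shows "(\<integral>\<^sup>+x. g (a - x) \<partial>lborel) = (\<integral>\<^sup>+x. g x \<partial>lborel)"
proof -
  have "(\<integral>\<^sup>+x. g x \<partial>lborel) = (\<integral>\<^sup>+x. g x \<partial>(density (distr lborel borel (\<lambda>x. a + (-1) *\<^sub>R x)) (\<lambda>_. ennreal (\<bar>-1\<bar> ^ DIM(real^'n)))))"
    using lborel_affine[of "-1" a] by simp
  also have "\<dots> = (\<integral>\<^sup>+x. g (a - x) \<partial>lborel)"
    by (simp add: nn_integral_density nn_integral_distr)
  finally show ?thesis ..
qed

text \<open>Uniqueness of translation invariant measures, specialized to images of Lebesgue measure.\<close>

lemma distr_lborel_orthogonal: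
  fixes f :: "real^'n \<Rightarrow> real^'n"
  assumes f: "orthogonal_transformation f"
  shows "distr lborel borel f = lborel"
proof (rule measure_eqI)
  fix A :: "(real^'n) set" assume "A \<in> sets (distr lborel borel f)"
  then have [measurable]: "A \<in> sets borel" by simp
  define B where "B = ball (0::real^'n) 1"
  have [measurable]: "B \<in> sets borel" by (simp add: B_def)
  have lin: "linear f" and bij: "bij f"
    using f by (auto simp: orthogonal_transformation_linear orthogonal_transformation_bij)
  have [measurable]: "f \<in> borel_measurable borel"
    by (intro borel_measurable_continuous_onI linear_continuous_on linear_conv_bounded_linear[THEN iffD1] lin)
  let ?\<nu> = "distr lborel borel f"
  have shift: "(\<integral>\<^sup>+x. g (f x) \<partial>lborel) = (\<integral>\<^sup>+x. g (f x - y) \<partial>lborel)"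
    if [measurable]: "g \<in> borel_measurable borel" for g :: "real^'n \<Rightarrow> ennreal" and y
  proof -
    obtain z where z: "f z = - y" using bij by (metis bij_pointE)
    have "(\<integral>\<^sup>+x. g (f x - y) \<partial>lborel) = (\<integral>\<^sup>+x. g (f (z + x)) \<partial>lborel)"
      by (simp add: linear_add[OF lin] z)
    also have "\<dots> = (\<integral>\<^sup>+x. g (f x) \<partial>lborel)"
      by (rule nn_integral_lborel_translate[where g = "\<lambda>x. g (f x)"]) measurable
    finally show ?thesis ..
  qed
  have em: "emeasure ?\<nu> C = (\<integral>\<^sup>+x. indicator C (f x) \<partial>lborel)" if [measurable]: "C \<in> sets borel" for C
  proof -
    have "emeasure ?\<nu> C = (\<integral>\<^sup>+x. indicator C x \<partial>?\<nu>)" by simp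
    also have "\<dots> = (\<integral>\<^sup>+x. indicator C (f x) \<partial>lborel)"
      by (subst nn_integral_distr) auto
    finally show ?thesis .
  qed
  have "emeasure ?\<nu> A * emeasure lborel B
      = (\<integral>\<^sup>+x. indicator A (f x) * (\<integral>\<^sup>+y. indicator B (f x + y) \<partial>lborel) \<partial>lborel)"
    by (simp add: em nn_integral_lborel_translate[where g = "indicator B"] nn_integral_multc)
  also have "\<dots> = (\<integral>\<^sup>+x. (\<integral>\<^sup>+y. indicator A (f x) * indicator B (f x + y) \<partial>lborel) \<partial>lborel)"
    by (simp add: nn_integral_cmult)
  also have "\<dots> = (\<integral>\<^sup>+y. (\<integral>\<^sup>+x. indicator A (f x) * indicator B (f x + y) \<partial>lborel) \<partial>lborel)"
    by (rule lborel_pair.Fubini') measurable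
  also have "\<dots> = (\<integral>\<^sup>+y. (\<integral>\<^sup>+x. indicator A (f x - y) * indicator B (f x) \<partial>lborel) \<partial>lborel)"
  proof (rule nn_integral_cong)
    fix y :: "real^'n"
    show "(\<integral>\<^sup>+x. indicator A (f x) * indicator B (f x + y) \<partial>lborel)
        = (\<integral>\<^sup>+x. indicator A (f x - y) * indicator B (f x) \<partial>lborel)"
      using shift[of "\<lambda>u. indicator A u * indicator B (u + y)" y] by simp
  qed
  also have "\<dots> = (\<integral>\<^sup>+x. (\<integral>\<^sup>+y. indicator A (f x - y) * indicator B (f x) \<partial>lborel) \<partial>lborel)"
    by (rule lborel_pair.Fubini') measurable
  also have "\<dots> = (\<integral>\<^sup>+x. emeasure lborel A * indicator B (f x) \<partial>lborel)"
    by (simp add: nn_integral_multc nn_integral_lborel_reflect[where g = "indicator A"])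
  also have "\<dots> = emeasure lborel A * emeasure ?\<nu> B"
    by (simp add: em nn_integral_cmult)
  also have "emeasure ?\<nu> B = emeasure lborel B"
  proof -
    have "f -` B = B"
      using f by (auto simp: B_def orthogonal_transformation_norm)
    then show ?thesis by (simp add: emeasure_distr)
  qed
  finally show "emeasure ?\<nu> A = emeasure lborel A"
    using emeasure_unit_ball[where 'n='n]
    by (simp add: B_def[symmetric] ennreal_mult_cancel_left mult.commute[of _ "emeasure lborel B"])
qed simp

lemma sphere_measure_invariant:
  fixes f :: "real^'n \<Rightarrow> real^'n"
  assumes f: "orthogonal_transformation f"
  shows "distr sphere_measure borel f = sphere_measure"
proof (rule measure_eqI)
  fix A :: "(real^'n) set" assume "A \<in> sets (distr sphere_measure borel f)"
  then have A [measurable]: "A \<in> sets borel" by simp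
  have lin: "linear f"
    using f by (simp add: orthogonal_transformation_linear)
  have fm [measurable]: "f \<in> borel_measurable borel"
    by (intro borel_measurable_continuous_onI linear_continuous_on linear_conv_bounded_linear[THEN iffD1] lin)
  have fA: "f -` A \<in> sets borel"
    using measurable_sets[OF fm A] by simp
  let ?S = "{x \<in> ball 0 1. x /\<^sub>R norm x \<in> A}"
  have "emeasure (distr sphere_measure borel f) A = emeasure sphere_measure (f -` A)"
    by (simp add: emeasure_distr)
  also have "\<dots> = emeasure lborel {x \<in> ball 0 1. x /\<^sub>R norm x \<in> f -` A} / emeasure lborel (ball (0::real^'n) 1)"
    by (rule emeasure_sphere_measure[OF fA])
  also have "{x \<in> ball 0 1. x /\<^sub>R norm x \<in> f -` A} = f -` ?S"
    using f by (auto simp: orthogonal_transformation_norm linear_scale[OF lin])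
  also have "emeasure lborel (f -` ?S) = emeasure (distr lborel borel f) ?S"
    by (subst emeasure_distr) auto
  also have "\<dots> = emeasure lborel ?S"
    by (simp add: distr_lborel_orthogonal[OF f])
  finally show "emeasure (distr sphere_measure borel f) A = emeasure sphere_measure A"
    by (simp add: emeasure_sphere_measure)
qed simp

lemma cap_measurable [measurable]: "cap R \<alpha> \<in> sets borel"
  unfolding cap_def by measurable

lemma measure_cap:
  fixes \<alpha> :: "real^'n"
  assumes "\<alpha> \<in> sphere 0 1"
  shows "measure sphere_measure (cap R \<alpha>) = cap_mass TYPE('n) R"
proof -
  define \<beta> :: "real^'n" where "\<beta> = (SOME \<alpha>. \<alpha> \<in> sphere 0 1)"
  have "norm \<beta> = 1"
    using someI[of "\<lambda>\<alpha>::real^'n. \<alpha> \<in> sphere 0 1", OF assms] by (simp add: \<beta>_def)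
  then obtain f where f: "orthogonal_transformation f" and fa: "f \<alpha> = \<beta>"
    using assms orthogonal_transformation_exists[of \<alpha> \<beta>] by auto
  have lin: "linear f"
    using f by (simp add: orthogonal_transformation_linear)
  have [measurable]: "f \<in> borel_measurable borel"
    by (intro borel_measurable_continuous_onI linear_continuous_on linear_conv_bounded_linear[THEN iffD1] lin)
  have "norm (f x - \<beta>) = norm (x - \<alpha>)" for x
    by (metis f fa lin linear_diff orthogonal_transformation_norm)
  then have "f -` cap R \<beta> = cap R \<alpha>"
    using f by (auto simp: cap_def orthogonal_transformation_norm)
  then have "measure (distr sphere_measure borel f) (cap R \<beta>) = measure sphere_measure (cap R \<alpha>)"
    by (simp add: measure_distr)
  then show ?thesis
    by (simp add: sphere_measure_invariant[OF f] cap_mass_def \<beta>_def)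
qed

lemma has_height_iff_smallest_common_denominator:
  fixes x :: "real^'n"
  shows "has_height x n \<longleftrightarrow> n \<ge> 1 \<and> (\<forall>i. of_nat n * x $ i \<in> \<int>) \<and>
     (\<forall>k\<ge>1. (\<forall>i. of_nat k * x $ i \<in> \<int>) \<longrightarrow> n \<le> k)"
proof
  assume "has_height x n"
  then obtain m :: "int^'n" where n: "n \<ge> 1" and m: "\<And>i. x $ i = of_int (m $ i) / of_nat n"
    and g: "Gcd (insert (int n) (range (\<lambda>i. m $ i))) = 1"
    by (auto simp: has_height_def)
  have "n \<le> k" if k: "k \<ge> 1" "\<forall>i. of_nat k * x $ i \<in> \<int>" for k
  proof -
    have "int n dvd int k * m $ i" for i
    proof -
      obtain z where "of_nat k * x $ i = of_int z" using k(2) Ints_cases by blast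
      then have "real_of_int (int k * m $ i) = real_of_int (int n * z)"
        using n by (simp add: m field_simps)
      then show ?thesis by (metis dvd_triv_left of_int_eq_iff)
    qed
    then have "int n dvd Gcd ((*) (int k) ` insert (int n) (range (\<lambda>i. m $ i)))"
      by (intro Gcd_greatest) auto
    then have "int n dvd int k" by (simp only: Gcd_mult g) simp
    then show ?thesis using k(1) by (simp add: dvd_imp_le)
  qed
  then show "n \<ge> 1 \<and> (\<forall>i. of_nat n * x $ i \<in> \<int>) \<and> (\<forall>k\<ge>1. (\<forall>i. of_nat k * x $ i \<in> \<int>) \<longrightarrow> n \<le> k)"
    using n by (simp add: m)
next
  assume *: "n \<ge> 1 \<and> (\<forall>i. of_nat n * x $ i \<in> \<int>) \<and> (\<forall>k\<ge>1. (\<forall>i. of_nat k * x $ i \<in> \<int>) \<longrightarrow> n \<le> k)"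
  define m :: "int^'n" where "m = (\<chi> i. \<lfloor>of_nat n * x $ i\<rfloor>)"
  define g where "g = nat (Gcd (insert (int n) (range (\<lambda>i. m $ i))))"
  have gG: "int g = Gcd (insert (int n) (range (\<lambda>i. m $ i)))"
    by (simp add: g_def del: Gcd_insert)
  have m: "of_int (m $ i) = of_nat n * x $ i" for i
    using * by (simp add: m_def)
  have "int g dvd int n" unfolding gG by (rule Gcd_dvd) simp
  then obtain k where k: "n = g * k" by (metis dvdE int_dvd_int_iff)
  have "of_nat k * x $ i \<in> \<int>" for i
  proof -
    have "int g dvd m $ i" unfolding gG by (rule Gcd_dvd) simp
    then obtain z where z: "m $ i = int g * z" by blast
    have "of_nat g * (of_nat k * x $ i) = of_nat g * of_int z"
      using m[of i, symmetric] by (simp add: z k mult_ac)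
    moreover have "real g \<noteq> 0" using * k by (cases "g = 0") auto
    ultimately have "of_nat k * x $ i = of_int z" by (metis mult_left_cancel)
    then show ?thesis by simp
  qed
  moreover have "k \<ge> 1" using * k by (cases k) auto
  ultimately have "n \<le> k" using * by blast
  then have "g = 1" using k * by (cases g) auto
  then have "Gcd (insert (int n) (range (\<lambda>i. m $ i))) = 1" using gG by simp
  moreover have "\<forall>i. x $ i = of_int (m $ i) / of_nat n" using * by (simp add: m)
  ultimately show "has_height x n" unfolding has_height_def using * by blast
qed

lemma finite_rational_points: "finite (rational_points T :: (real^'n) set)"
proof -
  define S where "S = (\<lambda>(a::int, n::nat). real_of_int a / real n) ` ({- int T..int T} \<times> {..T})"
  have "finite ((\<lambda>f. \<chi> i. f i) ` (PiE UNIV (\<lambda>_. S)) :: (real^'n) set)"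
    by (intro finite_imageI finite_PiE) (auto simp: S_def)
  moreover have "rational_points T \<subseteq> ((\<lambda>f. \<chi> i. f i) ` (PiE UNIV (\<lambda>_. S)) :: (real^'n) set)"
  proof
    fix x :: "real^'n" assume "x \<in> rational_points T"
    then obtain n and m :: "int^'n" where x: "norm x = 1" and n: "n \<le> T" "n \<ge> 1"
      and m: "\<And>i. x $ i = of_int (m $ i) / of_nat n"
      by (auto simp: rational_points_def has_height_def)
    have "x $ i \<in> S" for i
    proof -
      have "\<bar>real_of_int (m $ i)\<bar> \<le> n"
        using component_le_norm_cart[of x i] x n by (simp add: m field_simps)
      then have "\<bar>m $ i\<bar> \<le> int T" using n by linarith
      then show ?thesis using n by (auto simp: S_def m intro!: image_eqI[where x = "(m $ i, n)"])
    qed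
    then show "x \<in> (\<lambda>f. \<chi> i. f i) ` (PiE UNIV (\<lambda>_. S))"
      by (intro image_eqI[where x = "\<lambda>i. x $ i"]) (auto simp: PiE_def)
  qed
  ultimately show ?thesis by (rule finite_subset[rotated])
qed

end

theory Submission
  imports Defs "HOL-Computational_Algebra.Primes" "HOL-Real_Asymp.Real_Asymp"
begin

text \<open>A rational point \<open>p / q\<close> of the sphere is an integral isotropic vector \<open>(p, q)\<close> of the form
  \<open>\<bar>p\<bar>\<^sup>2 - q\<^sup>2\<close>, and \<open>\<bar>x - p / q\<bar>\<^sup>2 = 2 (q - x \<bullet> p) / q\<close>. Applying a Lorentz boost with parameter \<open>t\<close> along
  \<open>(x, 1)\<close> and looking for a bounded isotropic vector of the boosted lattice yields a Dirichlet theorem: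
  for all \<open>x\<close> and \<open>t \<ge> 1\<close> there is \<open>p / q\<close> with \<open>q \<le> C t\<close> and \<open>\<bar>x - p / q\<bar>\<^sup>2 \<le> C / (q t)\<close>.

  With \<open>t\<close> proportional to \<open>T\<close> this gives \<open>R(\<Omega>\<^sub>T) = O(T powr (-1/2))\<close>, which is sharp because no other
  rational point of height at most \<open>T\<close> is closer than \<open>(2 / T) powr (1/2)\<close> to a basis vector. If \<open>x\<close> has no
  rational point within \<open>T powr (\<epsilon> - 1)\<close>, then the point given by the Dirichlet theorem has height
  \<open>q = O(T powr (1 - 2 \<epsilon>))\<close>; since there are only \<open>O(Q powr (d + \<epsilon>))\<close> points of height at most \<open>Q\<close>, by
  the divisor bound, the set of such \<open>x\<close> has measure tending to 0. Comparing total volumes gives the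
  matching lower bounds for the number of points and for the generic covering exponent.\<close>

section \<open>Minkowski's theorem on linear forms\<close>

text \<open>Minkowski's theorem supplies short integral vectors but does not control the form on
  them, while a rational point requires an isotropic vector, with a constant independent of
  \<open>x\<close> and \<open>t\<close>. Discreteness closes the gap: an integral form takes only
  the value 0 below 1 in absolute value, and integral vectors of bounded boosted length have only
  finitely many Gram matrices. When such vectors span, the isotropic vector
  \<open>(axis k 1, 1)\<close> ensures that their Gram matrix has an integral zero.

  The exponents 2 and 1 differ because the Dirichlet error \<open>C / (q t)\<close> depends on the
  actual height \<open>q\<close>. It is worst for bounded \<open>q\<close>, and points near a basis
  vector force this case; but outside a set of small measure \<open>q\<close> is at least of order
  \<open>T powr (1 - 2 \<epsilon>)\<close>. A cap of radius \<open>R\<close> has mass of order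
  \<open>R ^ d\<close> and the number of points is \<open>T powr (d + o(1))\<close>, so radii
  \<open>T powr (-1/2)\<close> and \<open>T powr (\<epsilon> - 1)\<close> give 2 and
  \<open>1 / (1 - \<epsilon>)\<close>. Factors \<open>T powr \<epsilon>\<close> are harmless after
  division by \<open>ln T\<close>, which is why the divisor bound suffices for counting.\<close>

lemma blichfeldt:
  fixes S :: "(real^'m) set"
  assumes S: "S \<in> sets borel" and big: "emeasure lborel S > 1"
  obtains x y where "x \<in> S" "y \<in> S" "x \<noteq> y" "\<And>i. x $ i - y $ i \<in> \<int>"
proof -
  define v :: "int^'m \<Rightarrow> real^'m" where "v z = (\<chi> i. of_int (z $ i))" for z
  define Q :: "(real^'m) set" where "Q = {x. \<forall>i. 0 \<le> x $ i \<and> x $ i < 1}"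
  \<comment> \<open>\<open>S\<close> is cut along the integral unit cubes, and all pieces are moved
    into the single cube \<open>Q\<close>. Their total measure exceeds that of \<open>Q\<close>, so
    two of them overlap.\<close>
  define A where "A z = S \<inter> (+) (v z) ` Q" for z
  define B where "B z = (+) (- v z) ` A z" for z
  have Qb: "Q \<in> sets borel" unfolding Q_def by measurable
  have Qm: "Q \<in> sets lebesgue"
    using Qb by (simp add: sets_completionI_sets)
  have Am: "A z \<in> sets lebesgue" for z
    unfolding A_def using S Qm by (intro sets.Int lebesgue_sets_translation) auto
  have Bm: "B z \<in> sets lebesgue" for z
    unfolding B_def by (intro lebesgue_sets_translation Am)
  have eB: "emeasure lebesgue (B z) = emeasure lebesgue (A z)" for z
    using emeasure_lebesgue_affine[of 1 "- v z" "A z"] by (simp add: B_def add.commute)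
  have BQ: "B z \<subseteq> Q" for z by (auto simp: B_def A_def)
  have floorQ: "z = (\<chi> i. \<lfloor>x $ i\<rfloor>)" if "x \<in> (+) (v z) ` Q" for x z
    using that by (auto simp: Q_def v_def vec_eq_iff floor_eq_iff intro!: floor_unique[symmetric])
  have disjA: "disjoint_family A"
  proof -
    have "A z \<inter> A w = {}" if "z \<noteq> w" for z w
      using floorQ[of _ z] floorQ[of _ w] that by (auto simp only: A_def)
    then show ?thesis by (auto simp: disjoint_family_on_def)
  qed
  have UA: "(\<Union>z. A z) = S"
  proof -
    have "x \<in> A (\<chi> i. \<lfloor>x $ i\<rfloor>)" if "x \<in> S" for x
    proof -
      have "x = v (\<chi> i. \<lfloor>x $ i\<rfloor>) + (\<chi> i. frac (x $ i))"
        by (simp add: v_def vec_eq_iff frac_def)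
      moreover have "(\<chi> i. frac (x $ i)) \<in> Q" by (simp add: Q_def frac_lt_1)
      ultimately show ?thesis using that by (auto simp: A_def)
    qed
    moreover have "A z \<subseteq> S" for z by (simp add: A_def)
    ultimately show ?thesis by blast
  qed
  have "emeasure lebesgue Q \<le> emeasure lebesgue (cbox 0 (\<chi> i. 1) :: (real^'m) set)"
    by (rule emeasure_mono) (auto simp: Q_def mem_box_cart less_imp_le)
  also have "\<dots> = 1"
  proof -
    have "measure lborel (cbox 0 (\<chi> i. 1) :: (real^'m) set) = 1"
      by (subst content_cbox_cart) (auto simp: interval_ne_empty_cart)
    then show ?thesis by (simp add: emeasure_eq_ennreal_measure emeasure_lborel_cbox_eq)
  qed
  finally have Q1: "emeasure lebesgue Q \<le> 1" .
  have "\<not> disjoint_family B"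
  proof
    assume dB: "disjoint_family B"
    have "emeasure lebesgue S = (\<integral>\<^sup>+z. emeasure lebesgue (A z) \<partial>count_space UNIV)"
      unfolding UA[symmetric] using Am disjA by (intro emeasure_UN_countable) auto
    also have "\<dots> = (\<integral>\<^sup>+z. emeasure lebesgue (B z) \<partial>count_space UNIV)"
      by (simp add: eB)
    also have "\<dots> = emeasure lebesgue (\<Union>z. B z)"
      using Bm dB by (intro emeasure_UN_countable[symmetric]) auto
    also have "\<dots> \<le> emeasure lebesgue Q" using BQ Qm by (intro emeasure_mono) auto
    finally have "emeasure lebesgue S \<le> 1" using Q1 by simp
    then show False using big S by simp
  qed
  then obtain z w x where zw: "z \<noteq> w" "x \<in> B z" "x \<in> B w"
    by (auto simp: disjoint_family_on_def)
  have "v z + x \<in> S" "v w + x \<in> S" using zw by (auto simp: B_def A_def)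
  moreover have "v z + x \<noteq> v w + x" using zw by (auto simp: v_def vec_eq_iff)
  ultimately show ?thesis by (intro that[of "v z + x" "v w + x"]) (auto simp: v_def)
qed

text \<open>Blichfeldt's lemma is applied to the preimage of the box with one corner at 0. The
  difference of two points of that box is less than \<open>r i\<close> in each coordinate, so no
  power of 2 enters the volume condition.\<close>

lemma minkowski_linear_forms:
  fixes f :: "real^'m \<Rightarrow> real^'m" and r :: "'m \<Rightarrow> real"
  assumes lin: "linear f" and pres: "distr lborel borel f = lborel"
    and r: "\<And>i. r i > 0" and big: "1 < (\<Prod>i\<in>UNIV. r i)"
  obtains z where "z \<noteq> 0" "\<And>i. z $ i \<in> \<int>" "\<And>i. \<bar>f z $ i\<bar> < r i"
proof -
  define K :: "(real^'m) set" where "K = box 0 (\<chi> i. r i)"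
  have [measurable]: "f \<in> borel_measurable borel"
    by (intro borel_measurable_continuous_onI linear_continuous_on linear_conv_bounded_linear[THEN iffD1] lin)
  have K [measurable]: "K \<in> sets borel" by (simp add: K_def)
  have "cbox 0 (\<chi> i. r i) \<noteq> ({} :: (real^'m) set)"
    using r by (auto simp: interval_ne_empty_cart less_imp_le)
  then have "measure lborel K = (\<Prod>i\<in>UNIV. r i)"
    using content_cbox_cart[of 0 "\<chi> i. r i"]
    by (simp add: K_def measure_lborel_box_eq measure_lborel_cbox_eq)
  then have "emeasure lborel K > 1"
    using big emeasure_eq_ennreal_measure[of lborel K] emeasure_lborel_box_finite[of 0 "\<chi> i. r i"]
    by (metis K_def ennreal_less_iff ennreal_1 infinity_ennreal_def less_irrefl zero_le_one)
  also have "emeasure lborel K = emeasure (distr lborel borel f) K" by (simp add: pres)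
  also have "\<dots> = emeasure lborel (f -` K)" by (subst emeasure_distr) auto
  finally have "emeasure lborel (f -` K) > 1" .
  moreover have "f -` K \<in> sets borel" using measurable_sets[of f borel borel K] by simp
  ultimately obtain x y where xy: "x \<in> f -` K" "y \<in> f -` K" "x \<noteq> y" "\<And>i. x $ i - y $ i \<in> \<int>"
    using blichfeldt by blast
  have "\<bar>f (x - y) $ i\<bar> < r i" for i
    using xy(1,2) unfolding K_def vimage_eq mem_box_cart linear_diff[OF lin]
    by (auto simp: abs_less_iff dest!: spec[of _ i])
  with xy show ?thesis by (intro that[of "x - y"]) auto
qed

section \<open>Isotropic vectors of integral forms\<close>

lemma det_Ints:
  fixes A :: "real^'m^'m"
  assumes "\<And>i j. A $ i $ j \<in> \<int>"
  shows "det A \<in> \<int>"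
  unfolding det_def using assms by (intro Ints_sum Ints_mult Ints_prod) auto

text \<open>Makes the final constant independent of the map \<open>f\<close>: one solution is chosen
  for each of the finitely many Gram matrices, and the sum of their norms bounds them all.\<close>

lemma finite_bounded_witness:
  fixes P :: "'b \<Rightarrow> 'a::real_normed_vector \<Rightarrow> bool"
  assumes "finite A"
  obtains K where "K > 0" "\<And>G. G \<in> A \<Longrightarrow> \<exists>c. P G c \<Longrightarrow> \<exists>c. P G c \<and> norm c \<le> K"
proof -
  define w where "w G = (SOME c. P G c)" for G
  define K where "K = 1 + (\<Sum>G\<in>A. norm (w G))"
  have "\<exists>c. P G c \<and> norm c \<le> K" if "G \<in> A" "\<exists>c. P G c" for G
  proof -
    have "norm (w G) \<le> (\<Sum>G\<in>A. norm (w G))" using assms that by (intro member_le_sum) auto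
    then show ?thesis using someI_ex[OF that(2)] unfolding w_def K_def
      by (smt (verit) sum.cong)
  qed
  moreover have "K > 0" by (simp add: K_def add_pos_nonneg sum_nonneg)
  ultimately show ?thesis using that by blast
qed

text \<open>By Cramer's rule, a given isotropic integral vector becomes an integral combination of the basis
  after scaling by the determinant.\<close>

lemma isotropic_combination:
  fixes B :: "real^'m \<Rightarrow> real^'m \<Rightarrow> real" and z :: "'m \<Rightarrow> real^'m"
  assumes B: "bilinear B" and e: "e \<noteq> 0" "\<And>i. e $ i \<in> \<int>" "B e e = 0"
    and z: "\<And>i j. z i $ j \<in> \<int>" and Z: "Z = (\<chi> i j. z j $ i)" "det Z \<noteq> 0"
  shows "\<exists>c::real^'m. c \<noteq> 0 \<and> (\<forall>i. c $ i \<in> \<int>) \<and> (\<Sum>i\<in>UNIV. \<Sum>j\<in>UNIV. c $ i * c $ j * B (z i) (z j)) = 0"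
proof -
  define x :: "real^'m" where "x = (\<chi> k. det (\<chi> i j. if j = k then e $ i else Z $ i $ j) / det Z)"
  have Zx: "Z *v x = e" using cramer[OF Z(2), of x e] by (simp add: x_def)
  define c where "c = det Z *s x"
  have Zc: "Z *v c = det Z *s e" by (simp add: c_def vector_scalar_commute Zx)
  have "c $ i \<in> \<int>" for i
  proof -
    have "c $ i = det (\<chi> k j. if j = i then e $ k else Z $ k $ j)"
      using Z(2) by (simp add: c_def x_def)
    also have "\<dots> \<in> \<int>" using e(2) z by (intro det_Ints) (auto simp: Z(1))
    finally show ?thesis .
  qed
  moreover have "c \<noteq> 0" using Zc e(1) Z(2) by auto
  moreover have "(\<Sum>i\<in>UNIV. \<Sum>j\<in>UNIV. c $ i * c $ j * B (z i) (z j)) = B (Z *v c) (Z *v c)"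
  proof -
    have Zc': "Z *v c = (\<Sum>i\<in>UNIV. c $ i *\<^sub>R z i)"
      by (simp add: Z(1) vec_eq_iff matrix_vector_mult_def mult.commute)
    show ?thesis unfolding Zc'
      by (simp add: bilinear_sum[OF B] bilinear_lmul[OF B] bilinear_rmul[OF B] sum.cartesian_product case_prod_unfold mult.assoc mult.left_commute)
  qed
  moreover have "B (Z *v c) (Z *v c) = 0"
    by (simp add: Zc scalar_mult_eq_scaleR bilinear_lmul[OF B] bilinear_rmul[OF B] e(3))
  ultimately show ?thesis by auto
qed

text \<open>If the integral vectors with short image under \<open>f\<close> do not span, then Minkowski's theorem for a
  box that is long in a direction orthogonal to these images gives one of norm less than 1, and its
  preimage must be isotropic. Otherwise there is a basis of such vectors, and only finitely many Gram
  matrices can occur.\<close>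

lemma short_isotropic_vector:
  fixes B :: "real^'m \<Rightarrow> real^'m \<Rightarrow> real"
  assumes B: "bilinear B"
    and Bint: "\<And>x y. (\<And>i. x $ i \<in> \<int>) \<Longrightarrow> (\<And>i. y $ i \<in> \<int>) \<Longrightarrow> B x y \<in> \<int>"
    and e: "e \<noteq> 0" "\<And>i. e $ i \<in> \<int>" "B e e = 0"
  obtains C where "C > 0"
    "\<And>f :: real^'m \<Rightarrow> real^'m. linear f \<Longrightarrow> bij f \<Longrightarrow> distr lborel borel f = lborel \<Longrightarrow> (\<And>x y. \<bar>B x y\<bar> \<le> norm (f x) * norm (f y)) \<Longrightarrow>
        \<exists>z. z \<noteq> 0 \<and> (\<forall>i. z $ i \<in> \<int>) \<and> B z z = 0 \<and> norm (f z) \<le> C"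
proof -
  define N where "N = CARD('m)"
  have N0: "N > 0" by (simp add: N_def)
  \<comment> \<open>With one side \<open>R\<close> and the other \<open>N - 1\<close> sides
    \<open>1 / (2 N)\<close> the box has volume \<open>4 N > 1\<close>. Vectors in it have norm at
    most \<open>R + 1/2\<close>, hence the cutoff \<open>\<Lambda>\<close>.\<close>
  define R where "R = 2 * (2 * real N) ^ N"
  define \<Lambda> where "\<Lambda> = 1 + R"
  have R0: "R > 0" using N0 by (simp add: R_def)
  define \<G> :: "('m \<times> 'm \<Rightarrow> real) set" where "\<G> = PiE UNIV (\<lambda>_. {k \<in> \<int>. \<bar>k\<bar> \<le> \<Lambda> * \<Lambda>})"
  have fin: "finite \<G>" unfolding \<G>_def
    by (intro finite_PiE) (auto simp: finite_abs_int_segment)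
  define P where "P G c \<longleftrightarrow> c \<noteq> 0 \<and> (\<forall>i. c $ i \<in> \<int>) \<and> (\<Sum>i\<in>UNIV. \<Sum>j\<in>UNIV. c $ i * c $ j * G (i, j)) = 0"
    for G :: "'m \<times> 'm \<Rightarrow> real" and c :: "real^'m"
  obtain K where K: "K > 0" "\<And>G. G \<in> \<G> \<Longrightarrow> \<exists>c. P G c \<Longrightarrow> \<exists>c. P G c \<and> norm c \<le> K"
    using finite_bounded_witness[OF fin, of P] by blast
  \<comment> \<open>The summand 1 serves the non-spanning case, where the vector has norm at most
    1/2; the other bounds a combination of \<open>N\<close> vectors of length
    \<open>\<Lambda>\<close> with coefficients at most \<open>K\<close>.\<close>
  define C where "C = 1 + real N * (K * \<Lambda>)"
  have C1: "C \<ge> 1" using K(1) R0 by (simp add: C_def \<Lambda>_def)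
  have main: "\<exists>z. z \<noteq> 0 \<and> (\<forall>i. z $ i \<in> \<int>) \<and> B z z = 0 \<and> norm (f z) \<le> C"
    if lin: "linear f" and bij: "bij f" and pres: "distr lborel borel f = lborel"
      and Bf: "\<And>x y. \<bar>B x y\<bar> \<le> norm (f x) * norm (f y)" for f :: "real^'m \<Rightarrow> real^'m"
  proof -
    define S where "S = {z. (\<forall>i. z $ i \<in> \<int>) \<and> norm (f z) \<le> \<Lambda>}"
    show ?thesis
    proof (cases "span S = UNIV")
      case False
      obtain g where g: "linear g" "g \<circ> f = id" "f \<circ> g = id"
        using linear_injective_left_inverse[OF lin] bij
        by (metis bij_def lin linear_inverse_left)
      have "span (f ` S) \<noteq> UNIV"
      proof
        assume *: "span (f ` S) = UNIV"
        have "span S = span (g ` f ` S)" using g(2) by (simp add: image_comp)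
        also have "\<dots> = g ` UNIV" by (simp add: linear_span_image[OF g(1)] *)
        also have "\<dots> = UNIV" using g(2) by (metis comp_apply id_apply surjI)
        finally show False using False by simp
      qed
      then obtain a where a: "a \<noteq> 0" "\<And>x. x \<in> S \<Longrightarrow> a \<bullet> f x = 0"
        using span_not_UNIV_orthogonal[of "f ` S"] by (metis imageI span_base)
      define u where "u = a /\<^sub>R norm a"
      have u: "norm u = 1" "\<And>x. x \<in> S \<Longrightarrow> u \<bullet> f x = 0" using a by (auto simp: u_def)
      obtain k :: 'm where True by blast
      have "norm u = norm (axis k 1 :: real^'m)" by (simp add: u(1))
      then obtain h :: "real^'m \<Rightarrow> real^'m" where h: "orthogonal_transformation h" "h u = axis k 1"
        by (rule orthogonal_transformation_exists)
      define r where "r i = (if i = k then R else 1 / (2 * real N))" for i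
      have hlin: "linear h" using h orthogonal_transformation_linear by blast
      have meas: "f \<in> borel_measurable borel" "h \<in> borel_measurable borel"
        by (intro borel_measurable_continuous_onI linear_continuous_on linear_conv_bounded_linear[THEN iffD1] lin hlin)+
      have pres': "distr lborel borel (h \<circ> f) = lborel"
        using distr_distr[of h borel borel f lborel] meas by (simp add: pres distr_lborel_orthogonal[OF h(1)])
      have "(\<Prod>i\<in>UNIV. r i) = R * (1 / (2 * real N)) ^ (N - 1)"
        by (subst prod.remove[of _ k]) (auto simp: r_def N_def intro!: prod.cong)
      also have "\<dots> = 4 * real N"
        using N0 by (cases N) (auto simp: R_def field_simps)
      finally have "1 < (\<Prod>i\<in>UNIV. r i)" using N0 by simp
      moreover have "r i > 0" for i using R0 N0 by (simp add: r_def)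
      ultimately obtain z where z: "z \<noteq> 0" "\<And>i. z $ i \<in> \<int>" "\<And>i. \<bar>(h \<circ> f) z $ i\<bar> < r i"
        using minkowski_linear_forms[OF linear_compose[OF lin hlin] pres', of r] by metis
      have hz: "norm (f z) = norm (h (f z))" using orthogonal_transformation_norm[OF h(1)] by simp
      have sm: "(\<Sum>i\<in>UNIV - {k}. \<bar>h (f z) $ i\<bar>) \<le> 1 / 2"
      proof -
        have "(\<Sum>i\<in>UNIV - {k}. \<bar>h (f z) $ i\<bar>) \<le> (\<Sum>i\<in>UNIV - {k}. 1 / (2 * real N))"
        proof (rule sum_mono)
          fix i assume "i \<in> UNIV - {k}"
          then show "\<bar>h (f z) $ i\<bar> \<le> 1 / (2 * real N)" using z(3)[of i] by (simp add: r_def)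
        qed
        also have "\<dots> \<le> (\<Sum>i\<in>(UNIV::'m set). 1 / (2 * real N))" by (rule sum_mono2) auto
        also have "\<dots> = 1 / 2" using N0 by (simp add: N_def)
        finally show ?thesis .
      qed
      have nf: "norm (f z) \<le> \<bar>h (f z) $ k\<bar> + (\<Sum>i\<in>UNIV - {k}. \<bar>h (f z) $ i\<bar>)"
        unfolding hz using norm_le_l1_cart[of "h (f z)"] by (simp add: sum.remove[of UNIV k])
      have "\<bar>h (f z) $ k\<bar> < R" using z(3)[of k] by (simp add: r_def)
      then have "norm (f z) \<le> \<Lambda>" using nf sm by (simp add: \<Lambda>_def)
      then have "z \<in> S" using z(2) by (simp add: S_def)
      \<comment> \<open>The long side of the box gave only \<open>z \<in> S\<close>. But then
        \<open>f z\<close> is orthogonal to \<open>u\<close>, so its coordinate along that side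
        vanishes and the short sides alone bound the norm.\<close>
      have "h (f z) $ k = h (f z) \<bullet> h u" by (simp add: h(2) inner_axis)
      also have "\<dots> = f z \<bullet> u" using h(1) by (simp add: orthogonal_transformation_def)
      also have "\<dots> = 0" using u(2)[OF \<open>z \<in> S\<close>] by (simp add: inner_commute)
      finally have fz: "norm (f z) \<le> 1 / 2" using nf sm by simp
      have "\<bar>B z z\<bar> \<le> 1 / 2 * (1 / 2)"
        using Bf[of z z] fz by (smt (verit) mult_mono norm_ge_zero)
      moreover have "B z z \<in> \<int>" using Bint z(2) by blast
      ultimately have "B z z = 0" using Ints_nonzero_abs_less1[of "B z z"] by simp
      then show ?thesis using z fz C1 by (intro exI[of _ z]) auto
    next
      case True
      obtain b where b: "b \<subseteq> S" "independent b" "S \<subseteq> span b" "card b = dim S"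
        using basis_exists by metis
      have spb: "span b = UNIV" using b True by (metis span_mono span_span top.extremum_uniqueI)
      have cb: "card b = N"
        using b(4) True dim_span[of S] by (simp add: N_def)
      have finb: "finite b" using b(2) independent_imp_finite by blast
      obtain z where zb: "bij_betw z (UNIV::'m set) b"
        using finite_same_card_bij[of "UNIV::'m set" b] finb cb by (auto simp: N_def)
      have zS: "z i \<in> S" for i using zb b(1) by (auto simp: bij_betw_def)
      have z: "z i $ j \<in> \<int>" "norm (f (z i)) \<le> \<Lambda>" for i j using zS[of i] by (auto simp: S_def)
      define Z where "Z = (\<chi> i j. z j $ i)"
      have "columns Z = b"
        using zb by (auto simp: columns_def column_def Z_def bij_betw_def)
      then have "\<exists>X. Z ** X = mat 1"
        using matrix_right_invertible_span_columns[of Z] spb by (simp add: span_vec_eq)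
      then have inv: "invertible Z" using invertible_right_inverse by blast
      then have detZ: "det Z \<noteq> 0" using invertible_det_nz by blast
      define G where "G = (\<lambda>(i, j). B (z i) (z j))"
      have "G \<in> \<G>"
      proof -
        have "\<bar>B (z i) (z j)\<bar> \<le> \<Lambda> * \<Lambda>" for i j
          using Bf[of "z i" "z j"] z(2)[of i] z(2)[of j]
          by (smt (verit) mult_mono norm_ge_zero)
        moreover have "B (z i) (z j) \<in> \<int>" for i j using Bint z(1) by blast
        ultimately show ?thesis by (auto simp: \<G>_def G_def PiE_def)
      qed
      moreover have "\<exists>c. P G c"
        using isotropic_combination[OF B e z(1) Z_def detZ] by (simp add: P_def G_def)
      ultimately obtain c where c: "P G c" "norm c \<le> K" using K(2) by blast
      define y where "y = (\<Sum>i\<in>UNIV. c $ i *\<^sub>R z i)"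
      have yZ: "y = Z *v c"
        by (simp add: y_def Z_def vec_eq_iff matrix_vector_mult_def mult.commute)
      have "y \<noteq> 0" using inv c(1) unfolding yZ P_def
        by (metis invertible_def matrix_left_invertible_ker)
      moreover have "y $ i \<in> \<int>" for i
        using c(1) z(1) by (auto simp: y_def P_def intro!: Ints_sum Ints_mult)
      moreover have "B y y = 0"
        using c(1) unfolding y_def P_def
        by (simp add: bilinear_sum[OF B] bilinear_lmul[OF B] bilinear_rmul[OF B] G_def sum.cartesian_product mult_ac case_prod_unfold)
      moreover have "norm (f y) \<le> C"
      proof -
        have "norm (f y) = norm (\<Sum>i\<in>UNIV. c $ i *\<^sub>R f (z i))"
          by (simp add: y_def linear_sum[OF lin] linear_scale[OF lin])
        also have "\<dots> \<le> (\<Sum>i\<in>(UNIV::'m set). K * \<Lambda>)"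
        proof (rule sum_norm_le)
          fix i
          have "\<bar>c $ i\<bar> \<le> K" using component_le_norm_cart[of c i] c(2) by linarith
          then show "norm (c $ i *\<^sub>R f (z i)) \<le> K * \<Lambda>"
            using z(2)[of i] K(1) by (simp add: mult_mono)
        qed
        finally show ?thesis by (simp add: C_def N_def)
      qed
      ultimately show ?thesis by blast
    qed
  qed
  show ?thesis
  proof (rule that)
    show "C > 0" using C1 by simp
  qed (rule main, simp_all)
qed

section \<open>Dirichlet's theorem on the sphere\<close>

text \<open>Lebesgue measure is scaled by the product of the \<open>d i\<close>, which is 1. A boost
  is of this kind in light-cone coordinates.\<close>

lemma distr_lborel_diagonal:
  fixes d :: "'m::finite \<Rightarrow> real"
  assumes d: "\<And>i. d i > 0" and prod1: "(\<Prod>i\<in>UNIV. d i) = 1"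
  shows "distr lborel borel (\<lambda>x::real^'m. \<chi> i. d i * x $ i) = lborel"
proof -
  define v :: "real^'m" where "v = (\<chi> i. d i)"
  define T where "T x = (0::real^'m) + (\<Sum>b\<in>Basis. (v \<bullet> b * (x \<bullet> b)) *\<^sub>R b)" for x
  have "T x = (\<chi> i. d i * x $ i)" for x
  proof -
    have "T x \<bullet> b = (\<chi> i. d i * x $ i) \<bullet> b" if "b \<in> Basis" for b
    proof -
      have "T x \<bullet> b = v \<bullet> b * (x \<bullet> b)" using that by (simp add: T_def)
      then show ?thesis using that by (auto simp: v_def inner_axis Basis_vec_def)
    qed
    then show ?thesis by (rule euclidean_eqI)
  qed
  then have T: "(\<lambda>x. \<chi> i. d i * x $ i) = T" by auto
  have "v \<bullet> b \<noteq> 0" if "b \<in> Basis" for b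
    using that d by (auto simp: v_def Basis_vec_def inner_axis less_imp_neq[symmetric])
  then have "lborel = density (distr lborel borel T) (\<lambda>_. (\<Prod>b\<in>Basis. \<bar>v \<bullet> b\<bar>))"
    unfolding T_def by (intro lborel_affine_euclidean) auto
  moreover have "(\<Prod>b\<in>Basis. \<bar>v \<bullet> b\<bar>) = (\<Prod>i\<in>UNIV. d i)"
  proof -
    have B: "Basis = range (\<lambda>i. axis i 1 :: real^'m)" by (auto simp: Basis_vec_def)
    have inj: "inj (\<lambda>i. axis i 1 :: real^'m)" by (auto simp: inj_on_def axis_eq_axis)
    show ?thesis
      unfolding B prod.reindex[OF inj] using d by (simp add: v_def inner_axis less_imp_le)
  qed
  ultimately show ?thesis unfolding T by (simp add: prod1 density_1)
qed

lemma sum_UNIV_option: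
  "sum f (UNIV :: 'n::finite option set) = f None + (\<Sum>j\<in>UNIV. f (Some j))"
  by (simp add: UNIV_option_conv sum.reindex)

lemma prod_UNIV_option:
  "prod f (UNIV :: 'n::finite option set) = f None * (\<Prod>j\<in>UNIV. f (Some j))"
  by (simp add: UNIV_option_conv prod.reindex)

text \<open>A vector over \<open>'n option\<close> encodes the pair \<open>(p, q)\<close>: the
  coordinates \<open>Some j\<close> hold the numerators \<open>p\<close> and \<open>None\<close>
  holds the denominator \<open>q\<close>.\<close>

definition space_part :: "real^('n option) \<Rightarrow> real^'n" where
  "space_part z = (\<chi> j. z $ Some j)"

definition lorentz :: "real^('n::finite option) \<Rightarrow> real^('n option) \<Rightarrow> real" where
  "lorentz z w = space_part z \<bullet> space_part w - z $ None * w $ None"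

lemma bilinear_lorentz: "bilinear lorentz"
proof -
  have sp: "space_part (a + b) = space_part a + space_part b"
    "space_part (c *\<^sub>R a) = c *\<^sub>R space_part a" for a b :: "real^('n::finite option)" and c
    by (simp_all add: space_part_def vec_eq_iff)
  show ?thesis unfolding bilinear_def
    by (auto intro!: linearI simp: lorentz_def sp algebra_simps inner_add_left inner_add_right)
qed

text \<open>The coordinates \<open>(q - p \<bullet> x) / \<surd>2\<close>, \<open>(q + p \<bullet> x) / \<surd>2\<close> and the part of \<open>p\<close> orthogonal to \<open>x\<close>,
  with the first two scaled by \<open>t\<close> and \<open>1 / t\<close>: an orthogonal map followed by a Lorentz boost.\<close>

lemma boosted_frame:
  fixes x :: "real^'n"
  assumes x: "norm x = 1" and t: "t > 0"
  obtains f :: "real^('n option) \<Rightarrow> real^('n option)"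
  where "linear f" "bij f" "distr lborel borel f = lborel"
    "\<And>z w. \<bar>lorentz z w\<bar> \<le> norm (f z) * norm (f w)"
    "\<And>z. \<bar>z $ None - x \<bullet> space_part z\<bar> \<le> sqrt 2 * norm (f z) / t"
    "\<And>z. \<bar>z $ None + x \<bullet> space_part z\<bar> \<le> sqrt 2 * norm (f z) * t"
proof -
  obtain k :: 'n where True by blast
  have "norm x = norm (axis k 1 :: real^'n)" by (simp add: x)
  then obtain h :: "real^'n \<Rightarrow> real^'n" where h: "orthogonal_transformation h" "h x = axis k 1"
    by (rule orthogonal_transformation_exists)
  have hlin: "linear h" using h orthogonal_transformation_linear by blast
  have hin: "h a \<bullet> h b = a \<bullet> b" for a b using h(1) by (simp add: orthogonal_transformation_def)
  have hk: "h a $ k = x \<bullet> a" for a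
    using hin[of x a] by (simp add: h(2) inner_axis inner_commute)
  \<comment> \<open>\<open>F\<close> rotates \<open>x\<close> to a basis vector and fixes the
    denominator; \<open>H\<close> then passes to orthonormal light-cone coordinates in the plane of
    \<open>None\<close> and \<open>Some k\<close>.\<close>
  define F :: "real^('n option) \<Rightarrow> real^('n option)" where
    "F z = (\<chi> i. case i of None \<Rightarrow> z $ None | Some j \<Rightarrow> h (space_part z) $ j)" for z
  define H :: "real^('n option) \<Rightarrow> real^('n option)" where
    "H z = (\<chi> i. case i of None \<Rightarrow> (z $ None + z $ Some k) / sqrt 2
       | Some j \<Rightarrow> if j = k then (z $ None - z $ Some k) / sqrt 2 else z $ Some j)" for z
  \<comment> \<open>Reciprocal factors on the two null coordinates preserve both the volume and the
    product of these coordinates, hence the form.\<close>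
  define d where "d i = (case i of None \<Rightarrow> 1 / t | Some j \<Rightarrow> if j = k then t else 1)" for i
  define D :: "real^('n option) \<Rightarrow> real^('n option)" where "D z = (\<chi> i. d i * z $ i)" for z
  have in_opt: "z \<bullet> w = z $ None * w $ None + (\<Sum>j\<in>UNIV. z $ Some j * w $ Some j)"
    for z w :: "real^('n option)"
    by (simp add: inner_vec_def sum_UNIV_option)
  have in_split: "(\<Sum>j\<in>UNIV. a j) = a k + (\<Sum>j\<in>UNIV-{k}. a j)" for a :: "'n \<Rightarrow> real"
    by (simp add: sum.remove[of UNIV k])
  have sp: "space_part (a + b) = space_part a + space_part b"
    "space_part (c *\<^sub>R a) = c *\<^sub>R space_part a" for a b :: "real^('n option)" and c
    by (simp_all add: space_part_def vec_eq_iff)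
  have Flin: "linear F"
    by (rule linearI) (auto simp: F_def vec_eq_iff sp linear_add[OF hlin] linear_scale[OF hlin] split: option.split)
  have Hlin: "linear H"
    by (rule linearI) (auto simp: H_def vec_eq_iff field_simps split: option.split)
  have Dlin: "linear D"
    by (rule linearI) (auto simp: D_def vec_eq_iff algebra_simps)
  have spF: "space_part (F z) = h (space_part z)" for z
    by (simp add: F_def space_part_def)
  have Fin: "F z \<bullet> F w = z \<bullet> w" for z w
    using hin[of "space_part z" "space_part w"]
    by (simp add: in_opt F_def) (simp add: inner_vec_def space_part_def)
  have s2: "a / sqrt 2 * (b / sqrt 2) = a * b / 2" for a b :: real
    by simp
  have Hin: "H z \<bullet> H w = z \<bullet> w" for z w
    by (simp add: in_opt H_def in_split s2 del: times_divide_times_eq) (simp add: field_simps)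
  have orth: "orthogonal_transformation (H \<circ> F)"
    by (simp add: orthogonal_transformation_def linear_compose[OF Flin Hlin] Hin Fin)
  have d0: "d i > 0" for i using t by (simp add: d_def split: option.split)
  have "(\<Prod>j\<in>UNIV. d (Some j)) = t"
    by (simp add: d_def prod.remove[of UNIV k])
  then have "(\<Prod>i\<in>UNIV. d i) = 1" using t by (simp add: prod_UNIV_option) (simp add: d_def)
  then have Dpres: "distr lborel borel D = lborel"
    unfolding D_def using d0 by (intro distr_lborel_diagonal)
  define f where "f = D \<circ> (H \<circ> F)"
  show ?thesis
  proof (rule that[of f])
    have HFlin: "linear (H \<circ> F)" by (intro linear_compose Flin Hlin)
    show "linear f" unfolding f_def by (intro linear_compose Flin Hlin Dlin)
    have "D (\<chi> i. z $ i / d i) = z" "(\<chi> i. D z $ i / d i) = z" for z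
      using d0 by (simp_all add: D_def vec_eq_iff less_imp_neq[symmetric])
    then have "bij D" by (intro bij_betw_byWitness[where f' = "\<lambda>z. \<chi> i. z $ i / d i"]) auto
    then show "bij f" unfolding f_def
      by (rule bij_comp[OF orthogonal_transformation_bij[OF orth]])
    have meas: "D \<in> borel_measurable borel" "H \<circ> F \<in> borel_measurable borel"
      by (intro borel_measurable_continuous_onI linear_continuous_on linear_conv_bounded_linear[THEN iffD1] Dlin HFlin)+
    show "distr lborel borel f = lborel"
      using distr_distr[of D borel borel "H \<circ> F" lborel] meas
      by (simp add: f_def Dpres distr_lborel_orthogonal[OF orth])
    fix z
    have fN: "f z $ None = (z $ None + x \<bullet> space_part z) / (sqrt 2 * t)"
      by (simp add: f_def D_def H_def d_def F_def hk)
    have fk: "f z $ Some k = t * (z $ None - x \<bullet> space_part z) / sqrt 2"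
      by (simp add: f_def D_def H_def d_def F_def hk)
    show "\<bar>z $ None - x \<bullet> space_part z\<bar> \<le> sqrt 2 * norm (f z) / t"
    proof -
      have "t * \<bar>z $ None - x \<bullet> space_part z\<bar> / sqrt 2 \<le> norm (f z)"
        using component_le_norm_cart[of "f z" "Some k"] t unfolding fk by (simp add: abs_mult)
      then show ?thesis using t by (simp add: pos_le_divide_eq pos_divide_le_eq mult.commute)
    qed
    show "\<bar>z $ None + x \<bullet> space_part z\<bar> \<le> sqrt 2 * norm (f z) * t"
      using component_le_norm_cart[of "f z" None] t unfolding fN by (simp add: abs_mult field_simps)
  next
    fix z w
    \<comment> \<open>In light-cone coordinates the form is the inner product twisted by the
      isometry \<open>\<sigma>\<close>, which exchanges the null coordinates up to sign. Since
      \<open>D\<close> scales them reciprocally, the same formula holds for \<open>f\<close>, and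
      Cauchy-Schwarz gives the bound.\<close>
    define \<sigma> :: "real^('n option) \<Rightarrow> real^('n option)" where
      "\<sigma> b = (\<chi> i. case i of None \<Rightarrow> - b $ Some k | Some j \<Rightarrow> if j = k then - b $ None else b $ Some j)" for b
    have "\<sigma> b \<bullet> \<sigma> b = b \<bullet> b" for b
      by (simp add: in_opt \<sigma>_def in_split)
    then have n\<sigma>: "norm (\<sigma> b) = norm b" for b by (simp add: norm_eq_sqrt_inner)
    have "lorentz z w = lorentz (F z) (F w)"
      unfolding lorentz_def spF hin by (simp add: F_def)
    also have "\<dots> = H (F z) \<bullet> \<sigma> (H (F w))"
    proof -
      have "lorentz a b = (\<Sum>j\<in>UNIV. a $ Some j * b $ Some j) - a $ None * b $ None" for a b :: "real^('n option)"
        by (simp add: lorentz_def inner_vec_def space_part_def)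
      then show ?thesis
        by (simp add: in_opt \<sigma>_def H_def in_split s2 del: times_divide_times_eq) (simp add: field_simps)
    qed
    also have "\<dots> = f z \<bullet> \<sigma> (f w)"
      using t by (simp add: f_def D_def in_opt \<sigma>_def in_split d_def)
    finally show "\<bar>lorentz z w\<bar> \<le> norm (f z) * norm (f w)"
      using Cauchy_Schwarz_ineq2[of "f z" "\<sigma> (f w)"] by (simp add: n\<sigma>)
  qed
qed

text \<open>For the bounded isotropic vector, \<open>q - x \<bullet> p\<close> is of order at most
  \<open>1 / t\<close> and \<open>q + x \<bullet> p\<close> of order at most \<open>t\<close>. Their
  sum bounds the height and the first one the distance. Keeping \<open>q\<close> itself in the
  distance bound, rather than its upper bound, is what the generic exponent relies on.\<close>

lemma dirichlet_sphere:
  obtains C where "C \<ge> 1"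
    "\<And>(x::real^'n) t. norm x = 1 \<Longrightarrow> t \<ge> 1 \<Longrightarrow>
       \<exists>(q::nat) y. q \<ge> 1 \<and> real q \<le> C * t \<and> norm y = 1 \<and> (\<forall>i. real q * y $ i \<in> \<int>) \<and>
         (norm (x - y))\<^sup>2 \<le> C / (real q * t)"
proof -
  obtain k :: 'n where True by blast
  define e :: "real^('n option)" where
    "e = (\<chi> i. case i of None \<Rightarrow> 1 | Some j \<Rightarrow> if j = k then 1 else 0)"
  have spe: "space_part e = axis k 1" by (simp add: e_def space_part_def axis_def)
  have e: "e \<noteq> 0" "\<And>i. e $ i \<in> \<int>" "lorentz e e = 0"
  proof -
    have "e $ None \<noteq> 0" by (simp add: e_def)
    then show "e \<noteq> 0" by auto
    show "lorentz e e = 0" by (simp add: lorentz_def spe inner_axis) (simp add: e_def)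
  qed (simp add: e_def split: option.split)
  have lorentz_int: "lorentz z w \<in> \<int>" if "\<And>i. z $ i \<in> \<int>" "\<And>i. w $ i \<in> \<int>" for z w :: "real^('n option)"
    unfolding lorentz_def inner_vec_def
    using that by (auto simp: space_part_def intro!: Ints_diff Ints_sum Ints_mult)
  obtain C where C: "C > 0"
    "\<And>f :: real^('n option) \<Rightarrow> real^('n option). linear f \<Longrightarrow> bij f \<Longrightarrow> distr lborel borel f = lborel \<Longrightarrow>
      (\<And>x y. \<bar>lorentz x y\<bar> \<le> norm (f x) * norm (f y)) \<Longrightarrow>
        \<exists>z. z \<noteq> 0 \<and> (\<forall>i. z $ i \<in> \<int>) \<and> lorentz z z = 0 \<and> norm (f z) \<le> C"
    by (rule short_isotropic_vector[OF bilinear_lorentz lorentz_int e]) blast+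
  \<comment> \<open>The factor 2 is that of \<open>2 (q - x \<bullet> p) / q\<close>; the summand 1
    only ensures \<open>C' \<ge> 1\<close>.\<close>
  define C' where "C' = 1 + 2 * (sqrt 2 * C)"
  have C'1: "C' \<ge> 1" using C(1) by (simp add: C'_def)
  have "\<exists>(q::nat) y. q \<ge> 1 \<and> real q \<le> C' * t \<and> norm y = 1 \<and> (\<forall>i. real q * y $ i \<in> \<int>) \<and>
         (norm (x - y))\<^sup>2 \<le> C' / (real q * t)" if x: "norm x = 1" and t: "t \<ge> 1" for x :: "real^'n" and t
  proof -
    have t0: "t > 0" using t by simp
    obtain f :: "real^('n option) \<Rightarrow> real^('n option)" where f: "linear f" "bij f" "distr lborel borel f = lborel"
      "\<And>z w. \<bar>lorentz z w\<bar> \<le> norm (f z) * norm (f w)"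
      and fa: "\<And>z. \<bar>z $ None - x \<bullet> space_part z\<bar> \<le> sqrt 2 * norm (f z) / t"
      and fb: "\<And>z. \<bar>z $ None + x \<bullet> space_part z\<bar> \<le> sqrt 2 * norm (f z) * t"
      using boosted_frame[OF x t0] by blast
    obtain z where z: "z \<noteq> 0" "\<And>i. z $ i \<in> \<int>" "lorentz z z = 0" "norm (f z) \<le> C"
      using C(2)[OF f] by blast
    \<comment> \<open>The negative of \<open>z\<close> is isotropic too, so the denominator may be
      made positive. It is not 0, since isotropy would then force \<open>z = 0\<close>.\<close>
    define s where "s = sgn (z $ None)"
    define p where "p = s *\<^sub>R space_part z"
    have pz: "norm (space_part z) = \<bar>z $ None\<bar>"
      using z(3) by (simp add: lorentz_def norm_eq_sqrt_inner)
    have zN: "z $ None \<noteq> 0"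
    proof
      assume 0: "z $ None = 0"
      then have sp0: "space_part z = 0" using pz by simp
      have "z $ i = 0" for i
      proof (cases i)
        case (Some j)
        have "z $ Some j = space_part z $ j" by (simp add: space_part_def)
        then show ?thesis using Some sp0 by simp
      qed (use 0 in simp)
      then show False using z(1) by (simp add: vec_eq_iff)
    qed
    have s: "s = 1 \<or> s = -1" using zN by (auto simp: s_def sgn_if)
    have "\<bar>z $ None\<bar> \<in> \<int>" using z(2) by simp
    then have "\<bar>z $ None\<bar> \<in> \<nat>" by (simp add: Nats_altdef2)
    then obtain q where q: "\<bar>z $ None\<bar> = real q" by (auto elim: Nats_cases)
    have q1: "q \<ge> 1" using q zN by (cases q) auto
    have sq: "real q = s * z $ None" using q by (auto simp: s_def sgn_if abs_if split: if_splits)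
    define y where "y = p /\<^sub>R real q"
    have np: "norm p = real q" using s pz q by (auto simp: p_def)
    have ny: "norm y = 1" using np q1 by (simp add: y_def)
    have C2: "sqrt 2 * norm (f z) \<le> sqrt 2 * C" using z(4) by simp
    have xp: "x \<bullet> p = s * (x \<bullet> space_part z)" by (simp add: p_def)
    have "\<bar>real q - x \<bullet> p\<bar> = \<bar>z $ None - x \<bullet> space_part z\<bar>"
      using s by (auto simp: sq xp)
    also have "\<dots> \<le> sqrt 2 * C / t"
      using fa[of z] divide_right_mono[OF C2, of t] t0 by linarith
    finally have A: "\<bar>real q - x \<bullet> p\<bar> \<le> sqrt 2 * C / t" .
    have "\<bar>real q + x \<bullet> p\<bar> = \<bar>z $ None + x \<bullet> space_part z\<bar>"
      using s by (auto simp: sq xp)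
    also have "\<dots> \<le> sqrt 2 * C * t"
      using fb[of z] mult_right_mono[OF C2, of t] t0 by linarith
    finally have B: "\<bar>real q + x \<bullet> p\<bar> \<le> sqrt 2 * C * t" .
    have "sqrt 2 * C / t \<le> sqrt 2 * C / 1" using C(1) t by (intro divide_left_mono) auto
    moreover have "sqrt 2 * C * 1 \<le> sqrt 2 * C * t" using C(1) t by (intro mult_left_mono) auto
    ultimately have "2 * real q \<le> 2 * (sqrt 2 * C * t)" using A B by linarith
    also have "\<dots> \<le> C' * t" using t0 by (simp add: C'_def algebra_simps)
    finally have qt: "real q \<le> C' * t" using q1 by linarith
    have "(norm (x - y))\<^sup>2 = 2 - 2 * (x \<bullet> y)"
      using x ny by (simp add: power2_norm_eq_inner inner_diff_left inner_diff_right inner_commute norm_eq_1)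
    also have "\<dots> = 2 * (real q - x \<bullet> p) / real q"
      using q1 by (simp add: y_def field_simps)
    also have "\<dots> \<le> C' / t / real q"
    proof (rule divide_right_mono)
      have "real q - x \<bullet> p \<le> sqrt 2 * C / t" using A by (rule order_trans[OF abs_ge_self])
      then have "2 * (real q - x \<bullet> p) \<le> 2 * (sqrt 2 * C / t)" by simp
      also have "\<dots> \<le> C' / t" using t0 by (simp add: C'_def field_simps)
      finally show "2 * (real q - x \<bullet> p) \<le> C' / t" .
    qed simp
    finally have "(norm (x - y))\<^sup>2 \<le> C' / (real q * t)" by (simp add: mult.commute)
    moreover have "real q * y $ i \<in> \<int>" for i
    proof -
      have "real q * y $ i = s * z $ Some i" using q1 by (simp add: y_def p_def space_part_def)
      then show ?thesis using s z(2)[of "Some i"] by auto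
    qed
    ultimately show ?thesis using q1 qt ny by blast
  qed
  then show ?thesis using that[of C'] C'1 by blast
qed

section \<open>Counting rational points\<close>

lemma card_divisors_prime_power_mult:
  fixes p a m :: nat
  assumes p: "prime p" and m: "m > 0"
  shows "card {e. e dvd p ^ a * m} \<le> (a + 1) * card {e. e dvd m}"
proof -
  have "{e. e dvd p ^ a * m} \<subseteq> (\<lambda>(i, e). p ^ i * e) ` ({..a} \<times> {e. e dvd m})"
  proof
    fix e assume "e \<in> {e. e dvd p ^ a * m}"
    then obtain x y where xy: "e = x * y" "x dvd p ^ a" "y dvd m"
      by (auto elim: division_decomp[THEN exE] dest: division_decomp)
    then obtain i where "i \<le> a" "x = p ^ i" using divides_primepow_nat[OF p] by blast
    then show "e \<in> (\<lambda>(i, e). p ^ i * e) ` ({..a} \<times> {e. e dvd m})" using xy by auto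
  qed
  moreover have fin: "finite {e. e dvd m}" using m by simp
  ultimately have "card {e. e dvd p ^ a * m} \<le> card ({..a} \<times> {e. e dvd m})"
    by (meson card_image_le card_mono finite_SigmaI finite_atMost finite_imageI le_trans)
  then show ?thesis by (simp add: card_cartesian_product)
qed

text \<open>A prime power \<open>p ^ a\<close> exactly dividing \<open>n\<close> contributes the
  factor \<open>(a + 1) / p powr (a \<epsilon>)\<close> to the quotient of the divisor number by
  \<open>n powr \<epsilon>\<close>. It is at most 1 for \<open>p > P\<close> and at most
  \<open>D\<close> for each of the boundedly many other primes.\<close>

lemma divisor_bound:
  fixes \<epsilon> :: real
  assumes \<epsilon>: "\<epsilon> > 0"
  obtains C where "C > 0" "\<And>n::nat. n > 0 \<Longrightarrow> real (card {e. e dvd n}) \<le> C * real n powr \<epsilon>"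
proof -
  \<comment> \<open>For \<open>p > P\<close> one has \<open>p powr \<epsilon> \<ge> 2\<close>, so
    \<open>p powr (a \<epsilon>) \<ge> 2 ^ a \<ge> a + 1\<close>.\<close>
  define P :: nat where "P = nat \<lceil>2 powr (1 / \<epsilon>)\<rceil>"
  \<comment> \<open>Chosen so that \<open>a + 1 \<le> D (1 + a \<epsilon> ln 2)\<close>, where the
    second factor is at most \<open>2 powr (a \<epsilon>)\<close>.\<close>
  define D where "D = 1 + 1 / (\<epsilon> * ln 2)"
  have D1: "D \<ge> 1" using \<epsilon> by (simp add: D_def)
  have small: "real (a + 1) \<le> D * real p powr (real a * \<epsilon>)" if "prime p" for a p :: nat
  proof -
    have "p \<ge> 2" using that prime_ge_2_nat by blast
    have "1 + real a * \<epsilon> * ln 2 \<le> exp (real a * \<epsilon> * ln 2)" by (rule exp_ge_add_one_self)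
    also have "\<dots> = 2 powr (real a * \<epsilon>)" by (simp add: powr_def)
    also have "\<dots> \<le> real p powr (real a * \<epsilon>)" using \<open>p \<ge> 2\<close> \<epsilon> by (intro powr_mono2) auto
    finally have *: "1 + real a * \<epsilon> * ln 2 \<le> real p powr (real a * \<epsilon>)" .
    have "real (a + 1) \<le> D * (1 + real a * \<epsilon> * ln 2)"
      using \<epsilon> by (simp add: D_def field_simps)
    also have "\<dots> \<le> D * real p powr (real a * \<epsilon>)" using * D1 by (intro mult_left_mono) auto
    finally show ?thesis .
  qed
  have large: "real (a + 1) \<le> real p powr (real a * \<epsilon>)" if "p > P" for a p :: nat
  proof -
    have "2 powr (1 / \<epsilon>) \<le> real p" using that unfolding P_def by linarith
    then have "(2 powr (1 / \<epsilon>)) powr (real a * \<epsilon>) \<le> real p powr (real a * \<epsilon>)"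
      using \<epsilon> by (intro powr_mono2) auto
    moreover have "(2 powr (1 / \<epsilon>)) powr (real a * \<epsilon>) = 2 ^ a"
      using \<epsilon> by (simp add: powr_powr powr_realpow)
    moreover have "real (a + 1) \<le> 2 ^ a"
      by (induction a) auto
    ultimately show ?thesis by linarith
  qed
  \<comment> \<open>The exponent of \<open>D\<close>: removing the full power of a prime
    \<open>p \<le> P\<close> lowers it, which pays for one factor \<open>D\<close>.\<close>
  define k where "k n = card {p. prime p \<and> p \<le> P \<and> p dvd n}" for n
  have main: "real (card {e. e dvd n}) \<le> D ^ k n * real n powr \<epsilon>" if "n > 0" for n :: nat
    using that
  proof (induction n rule: less_induct)
    case (less n)
    show ?case
    proof (cases "n = 1")
      case True
      then show ?thesis using D1 by (simp add: one_le_power)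
    next
      case False
      then obtain p where p: "prime p" "p dvd n" using prime_factor_nat by blast
      obtain a m where am: "n = p ^ a * m" "\<not> p dvd m"
        using prime_power_canonical[OF p(1) less.prems] by (metis mult.commute)
      have m0: "m > 0" using am less.prems by (cases m) auto
      have a0: "a > 0" using am p by (cases a) auto
      have "m < n"
        using am m0 a0 one_less_power[OF prime_gt_1_nat[OF p(1)] a0] by simp
      have IH: "real (card {e. e dvd m}) \<le> D ^ k m * real m powr \<epsilon>"
        using less.IH[OF \<open>m < n\<close> m0] .
      have sub: "{q. prime q \<and> q \<le> P \<and> q dvd m} \<subseteq> {q. prime q \<and> q \<le> P \<and> q dvd n} - {p}"
        using am by auto
      have "real (a + 1) * D ^ k m \<le> D ^ k n * real p powr (real a * \<epsilon>)"
      proof (cases "p \<le> P")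
        case True
        have "k m < k n" unfolding k_def
          by (rule psubset_card_mono) (use sub p True am in auto)
        then have "D * D ^ k m \<le> D ^ k n"
          using D1 power_increasing[of "Suc (k m)" "k n" D] by simp
        have "real (a + 1) * D ^ k m \<le> (D * real p powr (real a * \<epsilon>)) * D ^ k m"
          using small[OF p(1)] D1 by (intro mult_right_mono) auto
        also have "\<dots> = (D * D ^ k m) * real p powr (real a * \<epsilon>)" by simp
        also have "\<dots> \<le> D ^ k n * real p powr (real a * \<epsilon>)"
          using \<open>D * D ^ k m \<le> D ^ k n\<close> by (intro mult_right_mono) auto
        finally show ?thesis .
      next
        case False
        have "k m \<le> k n" unfolding k_def
          by (rule card_mono) (use sub in auto)
        then have "D ^ k m \<le> D ^ k n" using D1 by (intro power_increasing)
        then have "real (a + 1) * D ^ k m \<le> real p powr (real a * \<epsilon>) * D ^ k n"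
          using large[of p a] False D1 by (intro mult_mono) auto
        then show ?thesis by (simp add: mult.commute)
      qed
      then have *: "real (a + 1) * D ^ k m * real m powr \<epsilon>
          \<le> D ^ k n * real p powr (real a * \<epsilon>) * real m powr \<epsilon>"
        by (intro mult_right_mono) auto
      have np: "real n powr \<epsilon> = real p powr (real a * \<epsilon>) * real m powr \<epsilon>"
        using p(1) by (simp add: am powr_mult powr_powr prime_gt_0_nat flip: powr_realpow)
      have "real (card {e. e dvd n}) \<le> real (a + 1) * real (card {e. e dvd m})"
        using card_divisors_prime_power_mult[OF p(1) m0, of a] unfolding am(1)
        by (metis of_nat_le_iff of_nat_mult)
      also have "\<dots> \<le> real (a + 1) * (D ^ k m * real m powr \<epsilon>)"
        using IH by (intro mult_left_mono) auto
      also have "\<dots> \<le> D ^ k n * real n powr \<epsilon>" using * by (simp add: np mult.assoc)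
      finally show ?thesis .
    qed
  qed
  show ?thesis
  proof (rule that[of "D ^ card {p. p \<le> P}"])
    show "D ^ card {p. p \<le> P} > 0" using D1 by simp
    fix n :: nat assume "n > 0"
    have "k n \<le> card {p. p \<le> P}" unfolding k_def by (rule card_mono) auto
    then have "D ^ k n \<le> D ^ card {p. p \<le> P}" using D1 by (intro power_increasing)
    then have "D ^ k n * real n powr \<epsilon> \<le> D ^ card {p. p \<le> P} * real n powr \<epsilon>"
      by (intro mult_right_mono) auto
    with main[OF \<open>n > 0\<close>] show "real (card {e. e dvd n}) \<le> D ^ card {p. p \<le> P} * real n powr \<epsilon>"
      by linarith
  qed
qed

text \<open>The height is at most any common denominator, so from here on fractions need not be
  reduced.\<close>

lemma rational_points_iff:
  "x \<in> rational_points T \<longleftrightarrow> norm x = 1 \<and> (\<exists>q\<ge>1. q \<le> T \<and> (\<forall>i. real q * x $ i \<in> \<int>))"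
proof
  assume "x \<in> rational_points T"
  then show "norm x = 1 \<and> (\<exists>q\<ge>1. q \<le> T \<and> (\<forall>i. real q * x $ i \<in> \<int>))"
    by (auto simp: rational_points_def has_height_iff_smallest_common_denominator)
next
  assume *: "norm x = 1 \<and> (\<exists>q\<ge>1. q \<le> T \<and> (\<forall>i. real q * x $ i \<in> \<int>))"
  then obtain q where q: "q \<ge> 1 \<and> (\<forall>i. real q * x $ i \<in> \<int>)" "q \<le> T" by blast
  let ?P = "\<lambda>q. q \<ge> 1 \<and> (\<forall>i. real q * x $ i \<in> \<int>)"
  have "has_height x (LEAST q. ?P q)"
    unfolding has_height_iff_smallest_common_denominator
    using LeastI[of ?P, OF q(1)] Least_le[of ?P] by blast
  moreover have "(LEAST q. ?P q) \<le> T" using Least_le[of ?P, OF q(1)] q(2) by simp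
  ultimately show "x \<in> rational_points T" using * by (auto simp: rational_points_def)
qed

text \<open>A rational point \<open>m / q\<close> is determined by all but one coordinate of \<open>m\<close> and the divisor
  \<open>q - m\<^sub>k\<close> of \<open>(q - m\<^sub>k) (q + m\<^sub>k) = (\<Sum>i\<noteq>k. m\<^sub>i\<^sup>2)\<close>.\<close>

lemma card_rational_points_le:
  assumes n: "CARD('n::finite) = d + 1" and \<delta>: "\<delta> > 0"
  obtains C where "C > 0"
    "\<And>T. T \<ge> 1 \<Longrightarrow> real (card (rational_points T :: (real^'n) set)) \<le> C * real T powr (real d + \<delta>)"
proof -
  \<comment> \<open>The number whose divisors are counted is at most \<open>d T\<^sup>2\<close>, so
    its power \<open>\<epsilon>\<close> costs a factor of order
    \<open>T powr \<delta>\<close>.\<close>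
  define \<epsilon> where "\<epsilon> = \<delta> / 2"
  have \<epsilon>: "\<epsilon> > 0" using \<delta> by (simp add: \<epsilon>_def)
  obtain A where A: "A > 0" "\<And>n::nat. n > 0 \<Longrightarrow> real (card {e. e dvd n}) \<le> A * real n powr \<epsilon>"
    using divisor_bound[OF \<epsilon>] by blast
  obtain k :: 'n where True by blast
  define I where "I = UNIV - {k}"
  have cI: "card I = d" using n by (simp add: I_def)
  have sumk: "sum f UNIV = f k + sum f I" for f :: "'n \<Rightarrow> 'a::comm_monoid_add"
    by (simp add: I_def sum.remove[of UNIV k])
  define C where "C = 2 + 3 ^ d * (A * (real d powr \<epsilon>))"
  have "real (card (rational_points T :: (real^'n) set)) \<le> C * real T powr (real d + \<delta>)" if T: "T \<ge> 1" for T
  proof -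
    let ?\<Omega> = "rational_points T :: (real^'n) set"
    define q where "q x = (SOME q. q \<ge> 1 \<and> q \<le> T \<and> (\<forall>i. real q * x $ i \<in> \<int>))" for x :: "real^'n"
    have q: "q x \<ge> 1" "q x \<le> T" "\<And>i. real (q x) * x $ i \<in> \<int>" if "x \<in> ?\<Omega>" for x
    proof -
      have "\<exists>q. q \<ge> 1 \<and> q \<le> T \<and> (\<forall>i. real q * x $ i \<in> \<int>)"
        using that by (auto simp: rational_points_iff)
      from someI_ex[OF this] show "q x \<ge> 1" "q x \<le> T" "\<And>i. real (q x) * x $ i \<in> \<int>"
        unfolding q_def by blast+
    qed
    define m where "m x i = \<lfloor>real (q x) * x $ i\<rfloor>" for x :: "real^'n" and i
    have m: "of_int (m x i) = real (q x) * x $ i" if "x \<in> ?\<Omega>" for x i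
      using q(3)[OF that] by (simp add: m_def)
    have xm: "x $ i = of_int (m x i) / real (q x)" if "x \<in> ?\<Omega>" for x i
      using m[OF that] q(1)[OF that] by simp
    have mT: "\<bar>m x i\<bar> \<le> int T" if "x \<in> ?\<Omega>" for x i
    proof -
      have "norm x = 1" using that by (simp add: rational_points_iff)
      then have "\<bar>x $ i\<bar> \<le> 1" using component_le_norm_cart[of x i] by simp
      then have "\<bar>real_of_int (m x i)\<bar> \<le> real (q x) * 1"
        unfolding m[OF that] abs_mult by (intro mult_mono) auto
      then show ?thesis using q(2)[OF that] by linarith
    qed
    define S where "S v = (\<Sum>i\<in>I. (v i)\<^sup>2)" for v :: "'n \<Rightarrow> int"
    have unit: "(\<Sum>i\<in>UNIV. (x $ i)\<^sup>2) = 1" if "x \<in> ?\<Omega>" for x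
      using that by (simp add: rational_points_iff norm_eq_sqrt_inner inner_vec_def power2_eq_square)
    have key: "S (m x) = (int (q x) - m x k) * (int (q x) + m x k)" if "x \<in> ?\<Omega>" for x
    proof -
      have "(\<Sum>i\<in>UNIV. (real (q x))\<^sup>2 * (x $ i)\<^sup>2) = (real (q x))\<^sup>2"
        using unit[OF that] by (simp flip: sum_distrib_left)
      then have "real_of_int (\<Sum>i\<in>UNIV. (m x i)\<^sup>2) = real_of_int ((int (q x))\<^sup>2)"
        by (simp add: m[OF that] power_mult_distrib)
      then have "(\<Sum>i\<in>UNIV. (m x i)\<^sup>2) = (int (q x))\<^sup>2" by (simp only: of_int_eq_iff)
      then show ?thesis unfolding sumk S_def[symmetric] by (simp add: algebra_simps power2_eq_square)
    qed
    have S0: "S v \<ge> 0" for v by (simp add: S_def sum_nonneg)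
    \<comment> \<open>Where the sum of squares is 0 every number is a divisor and the count breaks
      down. This concerns only the two points on the axis \<open>k\<close>, which give the summand 2
      in \<open>C\<close>.\<close>
    define \<Omega>' where "\<Omega>' = {x \<in> ?\<Omega>. S (m x) \<noteq> 0}"
    have "?\<Omega> - \<Omega>' \<subseteq> {axis k 1, axis k (-1)}"
    proof
      fix x assume "x \<in> ?\<Omega> - \<Omega>'"
      then have x: "x \<in> ?\<Omega>" and "S (m x) = 0" by (auto simp: \<Omega>'_def)
      then have "m x i = 0" if "i \<in> I" for i
        using that by (simp add: S_def sum_nonneg_eq_0_iff)
      then have xi: "x $ i = 0" if "i \<noteq> k" for i using that xm[OF x] by (simp add: I_def)
      then have xk: "x = axis k (x $ k)" by (simp add: vec_eq_iff axis_def)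
      have "(\<Sum>i\<in>I. (x $ i)\<^sup>2) = 0" using xi by (simp add: I_def)
      then have "(x $ k)\<^sup>2 = 1" using unit[OF x] by (simp add: sumk)
      then have "x $ k = 1 \<or> x $ k = -1" by (rule power2_eq_1_iff[THEN iffD1])
      then show "x \<in> {axis k 1, axis k (-1)}" using xk by auto
    qed
    then have "card (?\<Omega> - \<Omega>') \<le> card {axis k 1, axis k (-1) :: real^'n}" by (intro card_mono) auto
    also have "\<dots> \<le> 2" by (simp add: card_insert_if)
    finally have few: "card (?\<Omega> - \<Omega>') \<le> 2" .
    define V where "V = {v \<in> PiE I (\<lambda>_. {- int T..int T}). S v \<noteq> 0}"
    define W where "W = Sigma V (\<lambda>v. {e. e dvd nat (S v)})"
    \<comment> \<open>The first component determines the sum of squares, whose cofactor to the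
      divisor \<open>q - m k\<close> is \<open>q + m k\<close>. Together they recover
      \<open>q\<close> and \<open>m k\<close>, hence \<open>x\<close>. Since \<open>q - m k\<close>
      is positive on \<open>\<Omega>'\<close>, \<open>nat\<close> loses nothing.\<close>
    define g where "g x = (restrict (m x) I, nat (int (q x) - m x k))" for x
    have finI: "finite I" by simp
    have finV: "finite V" unfolding V_def
    by (rule finite_subset[of _ "PiE I (\<lambda>_. {- int T..int T})"]) (auto intro: finite_PiE finI)
    have S_restrict: "S (restrict v I) = S v" for v by (simp add: S_def)
    have pos: "int (q x) - m x k > 0" if "x \<in> \<Omega>'" for x
    proof -
      have x: "x \<in> ?\<Omega>" using that by (simp add: \<Omega>'_def)
      have "int (q x) - m x k \<noteq> 0" using that key[OF x] by (auto simp: \<Omega>'_def)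
      moreover have "x $ k \<le> 1"
        using component_le_norm_cart[of x k] x by (simp add: rational_points_iff abs_le_iff)
      then have "real_of_int (m x k) \<le> real (q x) * 1" unfolding m[OF x] by (intro mult_left_mono) auto
      then have "m x k \<le> int (q x)" by linarith
      ultimately show ?thesis by linarith
    qed
    have gW: "g ` \<Omega>' \<subseteq> W"
    proof
      fix w assume "w \<in> g ` \<Omega>'"
      then obtain x where x: "x \<in> \<Omega>'" "w = g x" by blast
      have xO: "x \<in> ?\<Omega>" and S: "S (m x) \<noteq> 0" using x by (auto simp: \<Omega>'_def)
      have "restrict (m x) I \<in> V"
        using mT[OF xO] S by (auto simp: V_def S_restrict abs_le_iff minus_le_iff)
      moreover have "nat (int (q x) - m x k) dvd nat (S (m x))"
        using pos[OF x(1)] S0[of "m x"] key[OF xO] by (simp add: nat_dvd_iff)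
      ultimately show "w \<in> W" by (simp add: x W_def g_def S_restrict)
    qed
    have inj: "inj_on g \<Omega>'"
    proof (rule inj_onI)
      fix x y assume xy: "x \<in> \<Omega>'" "y \<in> \<Omega>'" "g x = g y"
      have xO: "x \<in> ?\<Omega>" and yO: "y \<in> ?\<Omega>" using xy by (auto simp: \<Omega>'_def)
      have r: "restrict (m x) I = restrict (m y) I"
        and u: "int (q x) - m x k = int (q y) - m y k"
        using xy(3) pos[OF xy(1)] pos[OF xy(2)] by (auto simp: g_def)
      have mi: "m x i = m y i" if "i \<in> I" for i using r that by (metis restrict_apply')
      have "S (m x) = S (m y)" using r S_restrict by metis
      then have "int (q x) + m x k = int (q y) + m y k"
        using key[OF xO] key[OF yO] u pos[OF xy(2)] by simp
      with u have "q x = q y" "m x k = m y k" by linarith+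
      then have "x $ i = y $ i" for i
        using xm[OF xO, of i] xm[OF yO, of i] mi[of i] by (cases "i = k") (auto simp: I_def)
      then show "x = y" by (simp add: vec_eq_iff)
    qed
    have finW: "finite W" unfolding W_def
    proof (intro finite_SigmaI finV)
      fix v assume "v \<in> V"
      then have "nat (S v) > 0" using S0[of v] by (simp add: V_def)
      then show "finite {e. e dvd nat (S v)}" by simp
    qed
    have Sb: "real (nat (S v)) \<le> real d * (real T)\<^sup>2" if "v \<in> V" for v
    proof -
      have "(v i)\<^sup>2 \<le> (int T)\<^sup>2" if "i \<in> I" for i
        using that \<open>v \<in> V\<close> by (auto simp: V_def PiE_iff abs_le_square_iff[symmetric] abs_le_iff minus_le_iff)
      then have "S v \<le> int d * (int T)\<^sup>2"
        unfolding S_def using sum_bounded_above[of I "\<lambda>i. (v i)\<^sup>2" "(int T)\<^sup>2"] by (simp add: cI)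
      then have "real_of_int (S v) \<le> real_of_int (int d * (int T)\<^sup>2)" by (simp only: of_int_le_iff)
      then show ?thesis using S0[of v] by simp
    qed
    have dT: "card {e. e dvd nat (S v)} \<le> A * (real d powr \<epsilon> * real T powr \<delta>)" if "v \<in> V" for v
    proof -
      have "nat (S v) > 0" using that S0[of v] by (simp add: V_def)
      then have "card {e. e dvd nat (S v)} \<le> A * real (nat (S v)) powr \<epsilon>" by (rule A(2))
      also have "\<dots> \<le> A * (real d * (real T)\<^sup>2) powr \<epsilon>"
        using Sb[OF that] A(1) \<epsilon> by (intro mult_left_mono powr_mono2) auto
      also have "(real d * (real T)\<^sup>2) powr \<epsilon> = real d powr \<epsilon> * real T powr \<delta>"
        using T by (simp add: powr_mult powr_powr \<epsilon>_def flip: powr_numeral)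
      finally show ?thesis .
    qed
    have cV: "real (card V) \<le> (3 * real T) ^ d"
    proof -
      have "card V \<le> card (PiE I (\<lambda>_. {- int T..int T}))"
        unfolding V_def by (intro card_mono finite_PiE finI) auto
      also have "\<dots> = nat (2 * int T + 1) ^ d" by (simp add: card_PiE cI)
      finally have "real (card V) \<le> real (nat (2 * int T + 1)) ^ d" by (metis of_nat_le_iff of_nat_power)
      also have "\<dots> \<le> (3 * real T) ^ d" using T by (intro power_mono) auto
      finally show ?thesis .
    qed
    have "card \<Omega>' \<le> card W" using card_inj_on_le[OF inj gW finW] .
    also have "card W = (\<Sum>v\<in>V. card {e. e dvd nat (S v)})"
      unfolding W_def
    proof (rule card_SigmaI[OF finV], rule ballI)
      fix v assume "v \<in> V"
      then have "nat (S v) > 0" using S0[of v] by (simp add: V_def)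
      then show "finite {e. e dvd nat (S v)}" by simp
    qed
    finally have "real (card \<Omega>') \<le> (\<Sum>v\<in>V. real (card {e. e dvd nat (S v)}))"
      by (metis of_nat_le_iff of_nat_sum)
    also have "\<dots> \<le> real (card V) * (A * (real d powr \<epsilon> * real T powr \<delta>))"
      using dT by (rule sum_bounded_above)
    also have "\<dots> \<le> (3 * real T) ^ d * (A * (real d powr \<epsilon> * real T powr \<delta>))"
      using cV A(1) by (intro mult_right_mono) auto
    also have "\<dots> = 3 ^ d * (A * (real d powr \<epsilon>)) * real T powr (real d + \<delta>)"
      using T by (simp add: powr_add powr_realpow power_mult_distrib)
    finally have "real (card \<Omega>') \<le> 3 ^ d * (A * (real d powr \<epsilon>)) * real T powr (real d + \<delta>)" .
    moreover have "card ?\<Omega> \<le> card \<Omega>' + card (?\<Omega> - \<Omega>')"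
    proof -
      have "?\<Omega> = \<Omega>' \<union> (?\<Omega> - \<Omega>')" by (auto simp: \<Omega>'_def)
      then show ?thesis using card_Un_le[of \<Omega>' "?\<Omega> - \<Omega>'"] by simp
    qed
    moreover have "1 \<le> real T powr (real d + \<delta>)" using T \<delta> by (intro ge_one_powr_ge_zero) auto
    ultimately show ?thesis using few unfolding C_def by (simp add: algebra_simps)
  qed
  moreover have "C > 0" using A(1) by (simp add: C_def add_pos_nonneg)
  ultimately show ?thesis using that by blast
qed

section \<open>Caps\<close>

lemma measure_unit_ball_pos: "measure lborel (ball (0::real^'n) 1) > 0"
  using emeasure_unit_ball[where 'n='n]
  by (simp add: measure_def enn2real_positive_iff less_top zero_less_iff_neq_zero)

lemma measure_sphere_measure:
  fixes A :: "(real^'n) set"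
  assumes "A \<in> sets borel"
  shows "measure sphere_measure A =
    measure lborel {x \<in> ball 0 1. x /\<^sub>R norm x \<in> A} / measure lborel (ball (0::real^'n) 1)"
proof -
  have [measurable]: "A \<in> sets borel" by fact
  have "emeasure lborel {x \<in> ball 0 1. x /\<^sub>R norm x \<in> A} \<le> emeasure lborel (ball (0::real^'n) 1)"
    by (rule emeasure_mono) auto
  then have "emeasure lborel {x \<in> ball 0 1. x /\<^sub>R norm x \<in> A} \<noteq> \<infinity>"
    using emeasure_unit_ball(2)[where 'n='n] by (metis infinity_ennreal_def neq_top_trans)
  then show ?thesis
    using measure_unit_ball_pos emeasure_unit_ball(2)[where 'n='n]
    by (simp add: measure_def[of sphere_measure] emeasure_sphere_measure[OF assms] emeasure_eq_ennreal_measure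
        divide_ennreal)
qed

lemma finite_measure_sphere_measure: "finite_measure (sphere_measure :: (real^'n) measure)"
  by (rule finite_measureI) (simp add: prob_sphere_measure)

lemma measure_sphere_measure_UNIV: "measure sphere_measure (UNIV :: (real^'n) set) = 1"
  by (simp add: measure_def prob_sphere_measure)

lemma measure_lborel_cylinder:
  fixes k :: "'n::finite"
  assumes "a \<ge> 0" "b \<le> c" and n: "CARD('n) = d + 1"
  shows "measure lborel (cbox (\<chi> i. if i = k then b else - a) (\<chi> i. if i = k then c else a) :: (real^'n) set)
    = (2 * a) ^ d * (c - b)"
proof -
  have "measure lborel (cbox (\<chi> i. if i = k then b else - a) (\<chi> i. if i = k then c else a) :: (real^'n) set)
    = (\<Prod>i\<in>UNIV. if i = k then c - b else 2 * a)"
    using assms by (subst content_cbox_cart) (auto simp: interval_ne_empty_cart intro!: prod.cong)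
  also have "\<dots> = (c - b) * (\<Prod>i\<in>UNIV - {k}. 2 * a)"
    by (subst prod.remove[of _ k]) (auto intro!: prod.cong)
  also have "(\<Prod>i\<in>UNIV - {k}. 2 * a) = (2 * a) ^ d" using n by simp
  finally show ?thesis by simp
qed

text \<open>Radial projection moves a nonzero \<open>x\<close> by the difference between its norm
  and 1, which is at most its distance from the unit vector \<open>e\<close>.\<close>

lemma norm_normalize_diff_le:
  fixes x e :: "'a::real_inner"
  assumes "norm e = 1"
  shows "norm (x /\<^sub>R norm x - e) \<le> 2 * norm (x - e)"
proof (cases "x = 0")
  case True then show ?thesis using assms by simp
next
  case False
  have "norm (x /\<^sub>R norm x - x) = norm ((1 / norm x - 1) *\<^sub>R x)"
    by (simp add: algebra_simps divide_inverse)
  also have "\<dots> = \<bar>(1 / norm x - 1) * norm x\<bar>" by (simp add: abs_mult)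
  also have "\<dots> = \<bar>norm e - norm x\<bar>" using False assms by (simp add: algebra_simps)
  also have "\<dots> \<le> norm (x - e)" using norm_triangle_ineq3[of x e] by linarith
  finally have "norm (x /\<^sub>R norm x - x) \<le> norm (x - e)" .
  then show ?thesis using norm_triangle_ineq[of "x /\<^sub>R norm x - x" "x - e"] by simp
qed

text \<open>The part of the unit ball projecting into the cap lies in a box of length 2 along the
  axis and width \<open>2 R\<close> in the \<open>d\<close> other directions, because transverse
  coordinates shrink with the norm.\<close>

lemma cap_mass_upper:
  assumes n: "CARD('n::finite) = d + 1"
  obtains C where "C > 0" "\<And>R. R > 0 \<Longrightarrow> cap_mass TYPE('n) R \<le> C * R ^ d"
proof -
  let ?V = "measure lborel (ball (0::real^'n) 1)"
  obtain k :: 'n where True by blast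
  define e :: "real^'n" where "e = axis k 1"
  have e: "e \<in> sphere 0 1" by (simp add: e_def)
  have "cap_mass TYPE('n) R \<le> (2 ^ d * 2 / ?V) * R ^ d" if R: "R > 0" for R
  proof -
    let ?B = "cbox (\<chi> i. if i = k then -1 else - R) (\<chi> i. if i = k then 1 else R) :: (real^'n) set"
    have sub: "{x \<in> ball 0 1. x /\<^sub>R norm x \<in> cap R e} \<subseteq> ?B"
    proof
      fix x assume x: "x \<in> {x \<in> ball 0 1. x /\<^sub>R norm x \<in> cap R e}"
      then have x1: "norm x < 1" and xR: "norm (x /\<^sub>R norm x - e) < R" by (auto simp: cap_def)
      have "\<bar>x $ i\<bar> \<le> R" if "i \<noteq> k" for i
      proof -
        have "\<bar>(x /\<^sub>R norm x - e) $ i\<bar> \<le> norm (x /\<^sub>R norm x - e)" by (rule component_le_norm_cart)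
        moreover have "(x /\<^sub>R norm x - e) $ i = x $ i / norm x"
          using that by (simp add: e_def axis_def divide_inverse)
        ultimately have "\<bar>x $ i\<bar> / norm x < R" using xR by simp
        then have "\<bar>x $ i\<bar> \<le> R * norm x"
          by (cases "x = 0") (simp_all add: field_simps)
        also have "\<dots> \<le> R * 1" using x1 R by (intro mult_left_mono) auto
        finally show ?thesis by simp
      qed
      moreover have "\<bar>x $ k\<bar> \<le> 1" using component_le_norm_cart[of x k] x1 by linarith
      ultimately show "x \<in> ?B" by (auto simp: mem_box_cart abs_le_iff minus_le_iff)
    qed
    have "cap_mass TYPE('n) R = measure lborel {x \<in> ball 0 1. x /\<^sub>R norm x \<in> cap R e} / ?V"
      using measure_cap[OF e, of R] by (simp add: measure_sphere_measure)
    also have "\<dots> \<le> measure lborel ?B / ?V"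
    proof (intro divide_right_mono measure_mono_fmeasurable sub)
      show "{x \<in> ball 0 1. x /\<^sub>R norm x \<in> cap R e} \<in> sets lborel"
        using measurable_sets[OF radial_projection_measurable cap_measurable[of R e]] by simp
    qed auto
    also have "\<dots> = (2 ^ d * 2 / ?V) * R ^ d"
      using measure_lborel_cylinder[OF _ _ n, of R "-1" 1 k] R by (simp add: power_mult_distrib)
    finally show ?thesis .
  qed
  then show ?thesis using that[of "2 ^ d * 2 / ?V"] measure_unit_ball_pos[where 'n='n] by simp
qed

text \<open>A thin box around the axis between heights 1/2 and 3/4 projects into the cap; there the
  distance from the origin keeps the projection from magnifying transverse distances by more than a
  constant.\<close>

lemma cap_mass_lower:
  assumes n: "CARD('n::finite) = d + 1"
  obtains c where "c > 0" "\<And>R. 0 < R \<Longrightarrow> R \<le> 2 \<Longrightarrow> c * R ^ d \<le> cap_mass TYPE('n) R"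
proof -
  let ?V = "measure lborel (ball (0::real^'n) 1)"
  obtain k :: 'n where True by blast
  define e :: "real^'n" where "e = axis k 1"
  have e: "e \<in> sphere 0 1" by (simp add: e_def)
  \<comment> \<open>The \<open>d\<close> transverse coordinates then add up to less than
    \<open>R / 8\<close>. Rescaling to height 1 and projecting each cost a factor 2, leaving less
    than \<open>R\<close>; and \<open>R \<le> 2\<close> keeps the box inside the unit ball.\<close>
  define b where "b = 1 / (8 * real (d + 1))"
  have "((2 * b) ^ d * (1/4) / ?V) * R ^ d \<le> cap_mass TYPE('n) R" if R: "0 < R" "R \<le> 2" for R
  proof -
    let ?B = "cbox (\<chi> i. if i = k then 1/2 else - (b * R)) (\<chi> i. if i = k then 3/4 else b * R) :: (real^'n) set"
    have bR: "b * R > 0" using R by (simp add: b_def)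
    have sub: "?B \<subseteq> {x \<in> ball 0 1. x /\<^sub>R norm x \<in> cap R e}"
    proof
      fix x assume x: "x \<in> ?B"
      then have xk: "1/2 \<le> x $ k" "x $ k \<le> 3/4" and xi: "\<And>i. i \<noteq> k \<Longrightarrow> \<bar>x $ i\<bar> \<le> b * R"
        unfolding mem_box_cart by (force split: if_splits)+
      define w where "w = x - (x $ k) *\<^sub>R e"
      have "norm w \<le> (\<Sum>i\<in>UNIV. \<bar>w $ i\<bar>)" by (rule norm_le_l1_cart)
      also have "\<dots> = (\<Sum>i\<in>UNIV - {k}. \<bar>w $ i\<bar>)"
        by (subst sum.remove[of _ k]) (auto simp: w_def e_def)
      also have "\<dots> \<le> (\<Sum>i\<in>UNIV - {k}. b * R)"
        by (rule sum_mono) (use xi in \<open>auto simp: w_def e_def axis_def\<close>)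
      also have "\<dots> = real d * (b * R)" using n by simp
      also have "\<dots> < R / 8"
        using R by (simp add: b_def field_simps)
      finally have w: "norm w < R / 8" .
      have xw: "x = w + (x $ k) *\<^sub>R e" by (simp add: w_def)
      have x0: "x \<noteq> 0" using xk by auto
      have "norm x \<le> norm w + norm ((x $ k) *\<^sub>R e)" by (subst xw) (rule norm_triangle_ineq)
      also have "\<dots> < 1/4 + 3/4" using w R xk e by auto
      finally have nx: "norm x < 1" by simp
      define y where "y = x /\<^sub>R (x $ k)"
      have yx: "y /\<^sub>R norm y = x /\<^sub>R norm x" using xk by (simp add: y_def)
      have "y - e = w /\<^sub>R (x $ k)" using xk by (simp add: y_def w_def scaleR_diff_right)
      then have "norm (y - e) = norm (w /\<^sub>R (x $ k))" by (rule arg_cong)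
      also have "\<dots> = norm w / x $ k"
      proof -
        have "norm (w /\<^sub>R s) = norm w / s" if "s > 0" for s
          using that by (simp add: field_simps)
        then show ?thesis using xk by simp
      qed
      also have "\<dots> \<le> norm w / (1/2)" using xk by (intro divide_left_mono) auto
      finally have "norm (y - e) \<le> 2 * norm w" by simp
      then have "norm (x /\<^sub>R norm x - e) < R"
        using norm_normalize_diff_le[of e y] w e R unfolding yx by simp
      then show "x \<in> {x \<in> ball 0 1. x /\<^sub>R norm x \<in> cap R e}" using nx x0 by (auto simp: cap_def)
    qed
    have meas: "{x \<in> ball 0 1. x /\<^sub>R norm x \<in> cap R e} \<in> sets borel"
      using measurable_sets[OF radial_projection_measurable cap_measurable[of R e]] by simp
    have "((2 * b) ^ d * (1/4) / ?V) * R ^ d = measure lborel ?B / ?V"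
      using measure_lborel_cylinder[OF _ _ n, of "b * R" "1/2" "3/4" k] bR by (simp add: power_mult_distrib field_simps)
    also have "\<dots> \<le> measure lborel {x \<in> ball 0 1. x /\<^sub>R norm x \<in> cap R e} / ?V"
    proof (intro divide_right_mono measure_mono_fmeasurable sub)
      show "{x \<in> ball 0 1. x /\<^sub>R norm x \<in> cap R e} \<in> fmeasurable lborel"
      proof (rule fmeasurableI2)
        show "ball (0::real^'n) 1 \<in> fmeasurable lborel"
          by (intro fmeasurableI emeasure_bounded_finite) auto
      qed (use meas in auto)
    qed auto
    also have "\<dots> = cap_mass TYPE('n) R"
      using measure_cap[OF e, of R] by (simp add: measure_sphere_measure)
    finally show ?thesis .
  qed
  moreover have "(2 * b) ^ d * (1/4) / ?V > 0"
    using measure_unit_ball_pos[where 'n='n] by (simp add: b_def)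
  ultimately show ?thesis using that by blast
qed

text \<open>The antipodal cap of radius \<open>2 - R\<close> is disjoint from the given one and has
  positive mass. This makes the logarithms in the generic exponent strictly negative.\<close>

lemma cap_mass_less_1:
  assumes R: "0 < R" "R < 2"
  shows "cap_mass TYPE('n::finite) R < 1"
proof -
  obtain k :: 'n where True by blast
  define e :: "real^'n" where "e = axis k 1"
  have e: "e \<in> sphere 0 1" "- e \<in> sphere 0 1" by (simp_all add: e_def)
  interpret finite_measure "sphere_measure :: (real^'n) measure" by (rule finite_measure_sphere_measure)
  have "CARD('n) = (CARD('n) - 1) + 1" by simp
  from cap_mass_lower[OF this] obtain c
    where "c > 0" "\<And>R. 0 < R \<Longrightarrow> R \<le> 2 \<Longrightarrow> c * R ^ (CARD('n) - 1) \<le> cap_mass TYPE('n) R"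
    by blast
  from this(1) this(2)[of "2 - R"] have pos: "cap_mass TYPE('n) (2 - R) > 0"
    using R by (smt (verit) mult_pos_pos zero_less_power)
  have "cap R e \<inter> cap (2 - R) (- e) = {}"
  proof -
    have "norm (x - e) + norm (x - - e) \<ge> 2" for x
      using norm_triangle_ineq4[of "x - - e" "x - e"] e by (simp flip: scaleR_2)
    then show ?thesis unfolding cap_def by (smt (verit) disjoint_iff mem_Collect_eq)
  qed
  then have "measure sphere_measure (cap R e \<union> cap (2 - R) (- e)) = cap_mass TYPE('n) R + cap_mass TYPE('n) (2 - R)"
    using finite_measure_Union[of "cap R e" "cap (2 - R) (- e)"] by (simp add: measure_cap[OF e(1)] measure_cap[OF e(2)])
  then show ?thesis using pos bounded_measure[of "cap R e \<union> cap (2 - R) (- e)"] measure_sphere_measure_UNIV[where 'n='n]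
    by simp
qed

section \<open>The covering radius\<close>

text \<open>Moving \<open>y\<close> along the chord towards \<open>x\<close> strictly increases the
  inner product with \<open>x\<close>. As \<open>y \<bullet> x \<ge> 0\<close>, the moved point has
  positive inner product with \<open>x\<close>; its norm is at most 1, so projecting it back to the
  sphere cannot decrease that product. Thus even a boundary point is a limit of points of the open
  cap.\<close>

lemma closure_cap:
  fixes x y :: "real^'n"
  assumes x: "norm x = 1" and y: "norm y = 1" and R: "0 < R" "norm (y - x) \<le> R" and xy: "y \<bullet> x \<ge> 0"
  shows "y \<in> closure (cap R x)"
proof (cases "y = x")
  case True
  then show ?thesis using y R(1) by (intro closure_subset[THEN subsetD]) (auto simp: cap_def)
next
  case False
  have nd: "(norm (a - x))\<^sup>2 = 2 - 2 * (a \<bullet> x)" if "norm a = 1" for a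
    using that x by (simp add: power2_norm_eq_inner inner_diff_left inner_diff_right inner_commute norm_eq_1)
  have c1: "y \<bullet> x < 1"
  proof -
    have "0 < (norm (y - x))\<^sup>2" using False by simp
    then show ?thesis using nd[OF y] by simp
  qed
  define z where "z s = y + s *\<^sub>R (x - y)" for s
  define w where "w s = z s /\<^sub>R norm (z s)" for s
  have zx: "z s \<bullet> x > y \<bullet> x" if "s > 0" for s
  proof -
    have "z s \<bullet> x = y \<bullet> x + s * (1 - y \<bullet> x)"
      using x by (simp add: z_def inner_add_left inner_diff_left norm_eq_1)
    then show ?thesis using that c1 by simp
  qed
  have wcap: "w s \<in> cap R x" if s: "0 < s" "s \<le> 1" for s
  proof -
    have z0: "z s \<noteq> 0" using zx[OF s(1)] xy by auto
    then have nw: "norm (w s) = 1" by (simp add: w_def)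
    have "z s = (1 - s) *\<^sub>R y + s *\<^sub>R x" by (simp add: z_def algebra_simps)
    then have nz: "norm (z s) \<le> 1"
      using norm_triangle_ineq[of "(1 - s) *\<^sub>R y" "s *\<^sub>R x"] s x y by simp
    have "z s \<bullet> x * norm (z s) \<le> z s \<bullet> x * 1"
      using nz zx[OF s(1)] xy by (intro mult_left_mono) auto
    then have "z s \<bullet> x \<le> w s \<bullet> x" using z0 by (simp add: w_def field_simps)
    then have "(norm (w s - x))\<^sup>2 < (norm (y - x))\<^sup>2"
      using zx[OF s(1)] nd[OF nw] nd[OF y] by simp
    then have "norm (w s - x) < norm (y - x)" by (rule power2_less_imp_less) simp
    then show ?thesis using nw R(2) by (simp add: cap_def)
  qed
  have "(w \<longlongrightarrow> w 0) (at_right 0)"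
    unfolding w_def z_def using y by (intro tendsto_intros) auto
  moreover have "w 0 = y" using y by (simp add: w_def z_def)
  ultimately have lim: "(w \<longlongrightarrow> y) (at_right 0)" by simp
  have "eventually (\<lambda>s. w s \<in> closure (cap R x)) (at_right (0::real))"
    using eventually_at_right_less[of 0] eventually_at_right_real[of 0 1]
    by (auto elim!: eventually_mono intro!: closure_subset[THEN subsetD] wcap)
  then show ?thesis by (rule Lim_in_closed_set[OF closed_closure _ _ lim]) simp
qed

text \<open>The covering radius is the maximum over the sphere of the distance to \<open>X\<close>,
  attained by compactness. The assumption \<open>half\<close> makes \<open>closure_cap\<close>
  applicable to a nearest point, and \<open>ex\<close> makes the maximum positive, as the definition
  requires.\<close>

lemma covering_radius_characterization:
  fixes X :: "(real^'n) set"
  assumes X: "finite X" "X \<noteq> {}" "X \<subseteq> sphere 0 1"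
    and half: "\<And>y. norm y = 1 \<Longrightarrow> \<exists>x\<in>X. y \<bullet> x \<ge> 0"
    and ex: "\<exists>y. norm y = 1 \<and> y \<notin> X"
  shows "0 < covering_radius X"
    and "\<And>y. norm y = 1 \<Longrightarrow> \<exists>x\<in>X. norm (y - x) \<le> covering_radius X"
    and "\<exists>y. norm y = 1 \<and> (\<forall>x\<in>X. covering_radius X \<le> norm (y - x))"
proof -
  have cX: "closed X" using X(1) by (rule finite_imp_closed)
  have ne: "sphere (0::real^'n) 1 \<noteq> {}" using X by auto
  have "continuous_on (sphere 0 1) (\<lambda>y. infdist y X)" by (intro continuous_intros)
  then obtain y0 where y0: "norm y0 = 1" "\<And>y. norm y = 1 \<Longrightarrow> infdist y X \<le> infdist y0 X"
    using continuous_attains_sup[OF compact_sphere ne, of "\<lambda>y. infdist y X"]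
    by auto
  define r where "r = infdist y0 X"
  have near: "\<exists>x\<in>X. norm (y - x) \<le> r" if "norm y = 1" for y
  proof -
    obtain x where "x \<in> X" "infdist y X = dist y x"
      using infdist_attains_inf[OF cX X(2)] by blast
    then show ?thesis using y0(2)[OF that] by (auto simp: r_def dist_norm)
  qed
  have far: "r \<le> norm (y0 - x)" if "x \<in> X" for x
    using infdist_le[OF that, of y0] by (simp add: r_def dist_norm)
  obtain y1 where y1: "norm y1 = 1" "y1 \<notin> X" using ex by blast
  then have "infdist y1 X > 0" using cX X(2) by (metis infdist_pos_not_in_closed)
  then have r0: "r > 0" using y0(2)[OF y1(1)] by (simp add: r_def)
  have "covering_radius X = r"
    unfolding covering_radius_def
  proof (rule Least_equality)
    have "y \<in> (\<Union>x\<in>X. closure (cap r x))" if y: "norm y = 1" for y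
    proof -
      obtain a where a: "a \<in> X" "y \<bullet> a \<ge> 0" using half[OF y] by blast
      obtain b where b: "b \<in> X" "norm (y - b) = infdist y X"
        using infdist_attains_inf[OF cX X(2), of y] by (metis dist_norm)
      have ab: "norm (y - b) \<le> norm (y - a)" using b infdist_le[OF a(1), of y] by (simp add: dist_norm)
      have na: "norm a = 1" and nb: "norm b = 1" using a b X(3) by auto
      have nd: "(norm (y - c))\<^sup>2 = 2 - 2 * (y \<bullet> c)" if "norm c = 1" for c
        using that y by (simp add: power2_norm_eq_inner inner_diff_left inner_diff_right inner_commute norm_eq_1)
      have "(norm (y - b))\<^sup>2 \<le> (norm (y - a))\<^sup>2" using ab by (intro power_mono) auto
      \<comment> \<open>On the sphere a nearest point is one of largest inner product, so
        \<open>b\<close> inherits the sign from \<open>a\<close>.\<close>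
      then have "y \<bullet> b \<ge> 0" using a(2) nd[OF na] nd[OF nb] by simp
      moreover have "norm (y - b) \<le> r" using b(2) y0(2)[OF y] by (simp add: r_def)
      ultimately show ?thesis using closure_cap[OF nb y r0] b(1) by blast
    qed
    moreover have "closure (cap r x) \<subseteq> sphere 0 1" for x :: "real^'n"
      by (rule closure_minimal) (auto simp: cap_def)
    ultimately show "0 < r \<and> sphere 0 1 = (\<Union>x\<in>X. closure (cap r x))"
      using r0 by auto
  next
    fix R assume R: "0 < R \<and> sphere 0 1 = (\<Union>x\<in>X. closure (cap R x))"
    have "y0 \<in> sphere 0 1" using y0(1) by simp
    then have "y0 \<in> (\<Union>x\<in>X. closure (cap R x))" using R by simp
    then obtain x where x: "x \<in> X" "y0 \<in> closure (cap R x)" by blast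
    have "closure (cap R x) \<subseteq> cball x R"
      by (rule closure_minimal) (auto simp: cap_def dist_norm norm_minus_commute)
    then have "norm (y0 - x) \<le> R" using x(2) by (auto simp: dist_norm norm_minus_commute)
    then show "r \<le> R" using far[OF x(1)] by simp
  qed
  then show "0 < covering_radius X"
    and "\<And>y. norm y = 1 \<Longrightarrow> \<exists>x\<in>X. norm (y - x) \<le> covering_radius X"
    and "\<exists>y. norm y = 1 \<and> (\<forall>x\<in>X. covering_radius X \<le> norm (y - x))"
    using r0 near far y0(1) by auto
qed

lemma axis_rational_points:
  assumes "T \<ge> 1" "a = 1 \<or> a = -1"
  shows "axis k a \<in> rational_points T"
  using assms by (auto simp: rational_points_iff axis_def vec_eq_iff norm_eq_sqrt_inner inner_vec_def if_distrib if_distribR cong: if_cong intro!: exI[of _ 1])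

text \<open>A rational point of height \<open>q\<close> other than the basis vector \<open>e\<close> has squared distance
  \<open>2 (q - m\<^sub>k) / q \<ge> 2 / q\<close> from \<open>e\<close>.\<close>

lemma rational_points_gap:
  fixes T :: nat
  assumes n: "CARD('n::finite) \<ge> 2" and T: "T \<ge> 1"
  shows "\<exists>y::real^'n. norm y = 1 \<and> (\<forall>x\<in>rational_points T. norm (y - x) \<ge> 1 / sqrt (2 * real T))"
proof -
  obtain k :: 'n where True by blast
  have "card (UNIV - {k}) \<noteq> 0" using n by simp
  then obtain j where j: "j \<noteq> k" by (metis Diff_iff card.empty ex_in_conv insertI1)
  define e :: "real^'n" where "e = axis k 1"
  \<comment> \<open>Half of the gap \<open>sqrt (2 / T)\<close> around \<open>e\<close>: the point
    \<open>y\<close> at distance \<open>r\<close> from \<open>e\<close> is at least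
    \<open>2 r - r\<close> from every other rational point. Below, \<open>c\<close> is the inner
    product corresponding to the chord \<open>r\<close>.\<close>
  define r where "r = 1 / sqrt (2 * real T)"
  have r0: "r > 0" and r2: "r\<^sup>2 = 1 / (2 * real T)" using T by (simp_all add: r_def power_divide)
  have r1: "r\<^sup>2 \<le> 1" using T by (simp add: r2 field_simps)
  define c where "c = 1 - r\<^sup>2 / 2"
  have c: "0 \<le> c" "c \<le> 1" using r1 by (auto simp: c_def)
  then have c2: "c\<^sup>2 \<le> 1" by (simp add: power_le_one)
  define y :: "real^'n" where "y = axis k c + axis j (sqrt (1 - c\<^sup>2))"
  have yy: "y \<bullet> y = 1" using j c2
    by (simp add: y_def inner_add_left inner_add_right inner_axis_axis flip: power2_eq_square)
  have ny: "norm y = 1" using yy by (simp add: norm_eq_1)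
  have ye: "y \<bullet> e = c" using j by (simp add: y_def e_def inner_add_left inner_axis_axis)
  have ne: "norm e = 1" by (simp add: e_def)
  have nd: "(norm (a - b))\<^sup>2 = 2 - 2 * (a \<bullet> b)" if "norm a = 1" "norm b = 1" for a b :: "real^'n"
    using that by (simp add: power2_norm_eq_inner inner_diff_left inner_diff_right inner_commute norm_eq_1)
  have "(norm (y - e))\<^sup>2 = r\<^sup>2" using nd[OF ny ne] by (simp add: ye c_def)
  then have nye: "norm (y - e) = r" using r0 by (simp add: power2_eq_iff_nonneg)
  have "r \<le> norm (y - x)" if x: "x \<in> rational_points T" for x
  proof (cases "x = e")
    case True then show ?thesis by (simp add: nye)
  next
    case False
    obtain q where q: "q \<ge> 1" "q \<le> T" "real q * x $ k \<in> \<int>" and nx: "norm x = 1"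
      using x by (auto simp: rational_points_iff)
    have xe: "(norm (x - e))\<^sup>2 = 2 - 2 * x $ k"
      using nd[OF nx ne] by (simp add: e_def inner_axis)
    moreover have "(norm (x - e))\<^sup>2 > 0" using False by simp
    ultimately have "x $ k < 1" by simp
    then have lt: "real q * x $ k < real q" using q(1) by simp
    obtain i where i: "real q * x $ k = of_int i" using q(3) Ints_cases by blast
    with lt have "i \<le> int q - 1" by linarith
    then have "real q * x $ k \<le> real q - 1" unfolding i by linarith
    then have "1 / real q \<le> 1 - x $ k" using q(1) by (simp add: field_simps)
    moreover have "1 / real T \<le> 1 / real q" using q by (intro divide_left_mono) auto
    ultimately have "(2 * r)\<^sup>2 \<le> (norm (x - e))\<^sup>2" by (simp add: xe r2 power_mult_distrib)
    then have "2 * r \<le> norm (x - e)" by (rule power2_le_imp_le) simp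
    moreover have "norm (x - e) \<le> norm (y - x) + norm (y - e)"
      using norm_triangle_ineq4[of "y - e" "y - x"] by simp
    ultimately show ?thesis by (simp add: nye)
  qed
  then show ?thesis using ny unfolding r_def by blast
qed

text \<open>Dirichlet's theorem with \<open>t = N / C\<close>, so that the height is at most
  \<open>N\<close> itself; this turns \<open>C\<close> into \<open>C\<^sup>2\<close> and requires
  \<open>N \<ge> C\<close>.\<close>

lemma rational_points_near:
  obtains C where "C \<ge> 1"
    "\<And>(x::real^'n) N. norm x = 1 \<Longrightarrow> real N \<ge> C \<Longrightarrow>
       \<exists>q\<ge>1. \<exists>y. q \<le> N \<and> y \<in> rational_points q \<and> (norm (x - y))\<^sup>2 \<le> C\<^sup>2 / (real q * real N)"
proof -
  obtain C where C: "C \<ge> 1" "\<And>(x::real^'n) t. norm x = 1 \<Longrightarrow> t \<ge> 1 \<Longrightarrow>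
       \<exists>(q::nat) y. q \<ge> 1 \<and> real q \<le> C * t \<and> norm y = 1 \<and> (\<forall>i. real q * y $ i \<in> \<int>) \<and>
         (norm (x - y))\<^sup>2 \<le> C / (real q * t)"
    using dirichlet_sphere by blast
  have "\<exists>q\<ge>1. \<exists>y. q \<le> N \<and> y \<in> rational_points q \<and> (norm (x - y))\<^sup>2 \<le> C\<^sup>2 / (real q * real N)"
    if x: "norm x = 1" and N: "real N \<ge> C" for x :: "real^'n" and N
  proof -
    have "real N / C \<ge> 1" using N C(1) by simp
    from C(2)[OF x this] obtain q y where
      q: "q \<ge> 1" "real q \<le> C * (real N / C)" "norm y = 1" "\<forall>i. real q * y $ i \<in> \<int>"
         "(norm (x - y))\<^sup>2 \<le> C / (real q * (real N / C))" by blast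
    have "q \<le> N" using q(2) C(1) by simp
    moreover have "y \<in> rational_points q" using q by (auto simp: rational_points_iff)
    moreover have "(norm (x - y))\<^sup>2 \<le> C\<^sup>2 / (real q * real N)"
      using q(5) C(1) by (simp add: power2_eq_square)
    ultimately show ?thesis using q(1) by blast
  qed
  then show ?thesis using that C(1) by blast
qed

lemma covering_radius_rational_points:
  assumes n: "CARD('n::finite) \<ge> 2"
  obtains C where "C \<ge> 1" "\<And>N. real N \<ge> C \<Longrightarrow>
    1 / sqrt (2 * real N) \<le> covering_radius (rational_points N :: (real^'n) set) \<and>
    covering_radius (rational_points N :: (real^'n) set) \<le> C / sqrt (real N)"
proof -
  obtain C where C: "C \<ge> 1" "\<And>(x::real^'n) N. norm x = 1 \<Longrightarrow> real N \<ge> C \<Longrightarrow>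
       \<exists>q\<ge>1. \<exists>y. q \<le> N \<and> y \<in> rational_points q \<and> (norm (x - y))\<^sup>2 \<le> C\<^sup>2 / (real q * real N)"
    using rational_points_near by blast
  have "1 / sqrt (2 * real N) \<le> covering_radius (rational_points N :: (real^'n) set) \<and>
    covering_radius (rational_points N :: (real^'n) set) \<le> C / sqrt (real N)" if N: "real N \<ge> C" for N
  proof -
    let ?X = "rational_points N :: (real^'n) set"
    have N1: "N \<ge> 1" using N C(1) by simp
    obtain k :: 'n where True by blast
    \<comment> \<open>Two opposite basis vectors already meet every closed hemisphere.\<close>
    have half: "\<exists>x\<in>?X. y \<bullet> x \<ge> 0" for y
    proof (cases "y $ k \<ge> 0")
      case True
      then show ?thesis using axis_rational_points[OF N1, of 1 k] by (intro bexI[of _ "axis k 1"]) (auto simp: inner_axis)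
    next
      case False
      then show ?thesis using axis_rational_points[OF N1, of "-1" k] by (intro bexI[of _ "axis k (-1)"]) (auto simp: inner_axis)
    qed
    obtain g where g: "norm g = 1" "\<And>x. x \<in> ?X \<Longrightarrow> norm (g - x) \<ge> 1 / sqrt (2 * real N)"
      using rational_points_gap[OF n N1] by blast
    have pos: "1 / sqrt (2 * real N) > 0" using N1 by simp
    have "g \<notin> ?X" using g(2)[of g] pos by auto
    then have ex: "\<exists>y. norm y = 1 \<and> y \<notin> ?X" using g(1) by blast
    have sub: "?X \<noteq> {}" "?X \<subseteq> sphere 0 1" using half by (auto simp: rational_points_iff)
    note cr = covering_radius_characterization[OF finite_rational_points sub half ex]
    obtain x where "x \<in> ?X" "norm (g - x) \<le> covering_radius ?X" using cr(2)[OF g(1)] by blast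
    then have 1: "1 / sqrt (2 * real N) \<le> covering_radius ?X" using g(2) by fastforce
    obtain y where y: "norm y = 1" "\<And>x. x \<in> ?X \<Longrightarrow> covering_radius ?X \<le> norm (y - x)" using cr(3) by blast
    obtain q x where q: "q \<ge> 1" "q \<le> N" "x \<in> rational_points q" "(norm (y - x))\<^sup>2 \<le> C\<^sup>2 / (real q * real N)"
      using C(2)[OF y(1) N] by blast
    have "x \<in> ?X" using q by (auto simp: rational_points_iff)
    have "(norm (y - x))\<^sup>2 \<le> C\<^sup>2 / (real q * real N)" by (fact q(4))
    \<comment> \<open>Only \<open>q \<ge> 1\<close> is available for an arbitrary \<open>y\<close>;
      this worst case produces the order \<open>N powr (-1/2)\<close>.\<close>
    also have "\<dots> \<le> C\<^sup>2 / (1 * real N)" using q(1) N1 by (intro divide_left_mono mult_right_mono) auto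
    also have "\<dots> = (C / sqrt (real N))\<^sup>2" by (simp add: power_divide)
    finally have "norm (y - x) \<le> C / sqrt (real N)"
      by (rule power2_le_imp_le) (use C(1) in simp)
    then show ?thesis using 1 y(2)[OF \<open>x \<in> ?X\<close>] by simp
  qed
  then show ?thesis using that C(1) by blast
qed

section \<open>Generic covering\<close>

text \<open>The union bound behind both lower estimates: with known radii it bounds the number of
  points from below, with a known number of points it bounds the cap mass from below.\<close>

lemma one_minus_uncovered_le:
  fixes X :: "(real^'n) set"
  assumes X: "finite X" "X \<subseteq> sphere 0 1"
  shows "1 - measure sphere_measure (sphere 0 1 - (\<Union>x\<in>X. cap R x)) \<le> real (card X) * cap_mass TYPE('n) R"
proof -
  interpret finite_measure "sphere_measure :: (real^'n) measure" by (rule finite_measure_sphere_measure)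
  let ?U = "\<Union>x\<in>X. cap R x"
  have U [measurable]: "?U \<in> sets borel" using X(1) by (intro sets.finite_UN) auto
  have S: "sphere (0::real^'n) 1 \<in> sets borel" by (intro borel_closed) auto
  have "1 = measure sphere_measure (sphere (0::real^'n) 1)"
    by (simp add: measure_def emeasure_sphere_measure_sphere)
  also have "\<dots> = measure sphere_measure ((sphere 0 1 - ?U) \<union> ?U)"
    by (rule arg_cong[of _ _ "measure sphere_measure"]) (auto simp: cap_def)
  also have "\<dots> \<le> measure sphere_measure (sphere 0 1 - ?U) + measure sphere_measure ?U"
    using S U by (intro measure_Un_le) auto
  also have "measure sphere_measure ?U \<le> (\<Sum>x\<in>X. measure sphere_measure (cap R x))"
    using X(1) by (intro measure_UNION_le) auto
  also have "\<dots> = (\<Sum>x\<in>X. cap_mass TYPE('n) R)"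
    by (rule sum.cong) (use X(2) measure_cap[where 'n='n] in auto)
  finally show ?thesis by simp
qed

text \<open>Since \<open>s \<ge> 1\<close>, each term is at most
  \<open>Q powr (s - 1) * 2 ^ j\<close>, which leaves a geometric series and a constant independent
  of \<open>s\<close>.\<close>

lemma sum_powers_of_2_le:
  fixes Q s :: real
  assumes Q: "Q \<ge> 1" and s: "s \<ge> 1"
  shows "finite {j::nat. 2 ^ j \<le> Q}" "(\<Sum>j | 2 ^ j \<le> Q. (2 ^ j) powr s) \<le> 2 * Q powr s"
proof -
  have "nat \<lfloor>Q\<rfloor> \<ge> 1" using Q by linarith
  then obtain J :: nat where J: "2 ^ J \<le> nat \<lfloor>Q\<rfloor>" "nat \<lfloor>Q\<rfloor> < 2 ^ (J + 1)"
    using ex_power_ivl1[of 2 "nat \<lfloor>Q\<rfloor>"] by auto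
  have JQ: "2 ^ J \<le> Q" 
  proof -
    have "real (2 ^ J) \<le> real (nat \<lfloor>Q\<rfloor>)" using J(1) by (simp only: of_nat_le_iff)
    then have "real (2 ^ J) \<le> Q" using of_nat_floor[of Q] Q by linarith
    then show ?thesis by simp
  qed
  have sub: "{j::nat. 2 ^ j \<le> Q} \<subseteq> {..<J + 1}"
  proof
    fix j assume "j \<in> {j::nat. 2 ^ j \<le> Q}"
    then have "real_of_int (2 ^ j) \<le> Q" by simp
    then have "2 ^ j \<le> \<lfloor>Q\<rfloor>" by (simp only: le_floor_iff)
    then have "(2::nat) ^ j \<le> nat \<lfloor>Q\<rfloor>" by (simp add: le_nat_iff)
    then have "(2::nat) ^ j < 2 ^ (J + 1)" using J(2) by (rule le_less_trans)
    then have "j < J + 1" by (rule power_less_imp_less_exp[rotated]) simp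
    then show "j \<in> {..<J + 1}" by simp
  qed
  then show fin: "finite {j::nat. 2 ^ j \<le> Q}" by (rule finite_subset) simp
  have "(\<Sum>j | 2 ^ j \<le> Q. (2 ^ j) powr s) \<le> (\<Sum>j | 2 ^ j \<le> Q. Q powr (s - 1) * 2 ^ j)"
  proof (rule sum_mono)
    fix j :: nat assume "j \<in> {j. 2 ^ j \<le> Q}"
    then have "(2 ^ j) powr (s - 1) \<le> Q powr (s - 1)" using s by (intro powr_mono2) auto
    then have "(2 ^ j) powr (s - 1) * 2 ^ j \<le> Q powr (s - 1) * 2 ^ j" by (intro mult_right_mono) auto
    moreover have "(2 ^ j) powr s = (2 ^ j) powr (s - 1) * (2 ^ j :: real)"
      using powr_add[of "2 ^ j" "s - 1" 1] by simp
    ultimately show "(2 ^ j) powr s \<le> Q powr (s - 1) * 2 ^ j" by simp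
  qed
  also have "\<dots> = Q powr (s - 1) * (\<Sum>j | 2 ^ j \<le> Q. 2 ^ j)" by (simp add: sum_distrib_left)
  also have "(\<Sum>j | 2 ^ j \<le> Q. 2 ^ j :: real) \<le> (\<Sum>j<J + 1. 2 ^ j)"
    by (rule sum_mono2) (use sub in auto)
  also have "(\<Sum>j<J + 1. 2 ^ j :: real) = 2 ^ (J + 1) - 1"
    by (subst geometric_sum) auto
  also have "\<dots> \<le> 2 * Q" using JQ by simp
  finally have "(\<Sum>j | 2 ^ j \<le> Q. (2 ^ j) powr s) \<le> Q powr (s - 1) * (2 * Q)"
    by (simp add: mult_left_mono)
  also have "\<dots> = 2 * Q powr s" using Q powr_add[of Q "s - 1" 1] by simp
  finally show "(\<Sum>j | 2 ^ j \<le> Q. (2 ^ j) powr s) \<le> 2 * Q powr s" .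
qed

text \<open>A point without a rational point of height at most \<open>N\<close> within \<open>N powr (\<epsilon> - 1)\<close> is, by
  Dirichlet's theorem, close to a rational point of much smaller height \<open>q\<close>; these neighbourhoods are
  summed over dyadic ranges of \<open>q\<close>.\<close>

lemma generic_covering_rational_points:
  assumes n: "CARD('n::finite) = d + 1" and d: "d \<ge> 2" and \<epsilon>: "0 < \<epsilon>" "\<epsilon> \<le> 1/2"
    and r: "\<And>N. N \<ge> 2 \<Longrightarrow> r N = real N powr (\<epsilon> - 1)"
  shows "(\<lambda>N. measure sphere_measure (sphere 0 1 - (\<Union>x\<in>rational_points N. cap (r N) x :: (real^'n) set)))
    \<longlonglongrightarrow> 0"
proof -
  interpret finite_measure "sphere_measure :: (real^'n) measure" by (rule finite_measure_sphere_measure)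
  obtain C where C: "C \<ge> 1" "\<And>(x::real^'n) N. norm x = 1 \<Longrightarrow> real N \<ge> C \<Longrightarrow>
       \<exists>q\<ge>1. \<exists>y. q \<le> N \<and> y \<in> rational_points q \<and> (norm (x - y))\<^sup>2 \<le> C\<^sup>2 / (real q * real N)"
    using rational_points_near by blast
  obtain A where A: "A > 0" "\<And>T. T \<ge> 1 \<Longrightarrow>
      real (card (rational_points T :: (real^'n) set)) \<le> A * real T powr (real d + \<epsilon>)"
    using card_rational_points_le[OF n \<epsilon>(1)] by blast
  obtain B where B: "B > 0" "\<And>R. R > 0 \<Longrightarrow> cap_mass TYPE('n) R \<le> B * R ^ d"
    using cap_mass_upper[OF n] by blast
  \<comment> \<open>Up to constants, a dyadic range contributes
    \<open>(2 ^ j) powr (d + \<epsilon>)\<close> points with caps of mass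
    \<open>(2 ^ j * N) powr (- d / 2)\<close>; the powers of \<open>2 ^ j\<close> combine to
    \<open>s\<close>.\<close>
  define s where "s = real d / 2 + \<epsilon>"
  have s1: "s \<ge> 1" using d \<epsilon> by (simp add: s_def)
  define D where "D = A * 2 powr (real d + \<epsilon>) * (B * (2 * C) ^ d)"
  have D0: "D > 0" using A(1) B(1) C(1) by (simp add: D_def)
  \<comment> \<open>The bound on \<open>q\<close> obtained from
    \<open>N powr (2 \<epsilon> - 2) \<le> C\<^sup>2 / (q N)\<close>.\<close>
  define Q where "Q N = C\<^sup>2 * real N powr (1 - 2 * \<epsilon>)" for N
  let ?U = "\<lambda>N. sphere 0 1 - (\<Union>x\<in>rational_points N. cap (r N) x :: (real^'n) set)"
  have bound: "measure sphere_measure (?U N) \<le> D * real N powr (- real d / 2) * (2 * Q N powr s)"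
    if N: "real N \<ge> C" "N \<ge> 2" for N
  proof -
    have N0: "real N > 0" using N by simp
    \<comment> \<open>For \<open>2 ^ j \<le> q\<close> Dirichlet's bound is at most
      \<open>C / sqrt (2 ^ j * N)\<close>; doubling it makes the inequality strict, as caps are
      open.\<close>
    define \<rho> where "\<rho> j = 2 * C / sqrt (2 ^ j * real N)" for j :: nat
    have \<rho>0: "\<rho> j > 0" for j using C(1) N0 by (simp add: \<rho>_def)
    define V where "V j = (\<Union>y\<in>rational_points (2 ^ (j + 1)). cap (\<rho> j) y :: (real^'n) set)" for j
    have "1 \<le> C\<^sup>2" using C(1) by simp
    moreover have "1 \<le> real N powr (1 - 2 * \<epsilon>)" using N \<epsilon> by (intro ge_one_powr_ge_zero) auto
    ultimately have Q1: "Q N \<ge> 1" unfolding Q_def using mult_mono[of 1 "C\<^sup>2" 1 "real N powr (1 - 2 * \<epsilon>)"] by simp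
    note fin = sum_powers_of_2_le(1)[OF Q1 s1]
    have Vm: "V j \<in> sets borel" for j
      unfolding V_def by (intro sets.finite_UN finite_rational_points) auto
    have sub: "?U N \<subseteq> (\<Union>j\<in>{j. 2 ^ j \<le> Q N}. V j)"
    proof
      fix x assume x: "x \<in> ?U N"
      then have nx: "norm x = 1" by simp
      obtain q y where q: "q \<ge> 1" "q \<le> N" "y \<in> rational_points q"
          "(norm (x - y))\<^sup>2 \<le> C\<^sup>2 / (real q * real N)"
        using C(2)[OF nx N(1)] by blast
      have "y \<in> rational_points N" using q by (auto simp: rational_points_iff)
      then have far: "real N powr (\<epsilon> - 1) \<le> norm (x - y)" using x nx r[OF N(2)] by (auto simp: cap_def)
      have "real N powr (2 * \<epsilon> - 2) = (real N powr (\<epsilon> - 1))\<^sup>2"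
        using N0 by (simp add: powr_powr algebra_simps flip: powr_numeral)
      also have "\<dots> \<le> (norm (x - y))\<^sup>2" using far by (intro power_mono) auto
      finally have le: "real N powr (2 * \<epsilon> - 2) \<le> C\<^sup>2 / (real q * real N)" using q(4) by linarith
      have "real q = real q * real N * real N powr (2 * \<epsilon> - 2) * real N powr (1 - 2 * \<epsilon>)"
        using N0 by (simp add: mult.assoc powr_mult_base flip: powr_add)
      also have "real q * real N * real N powr (2 * \<epsilon> - 2) * real N powr (1 - 2 * \<epsilon>)
          \<le> real q * real N * (C\<^sup>2 / (real q * real N)) * real N powr (1 - 2 * \<epsilon>)"
        using le by (intro mult_right_mono mult_left_mono) auto
      also have "\<dots> = Q N" using q(1) N0 by (simp add: Q_def)
      finally have qQ: "real q \<le> Q N" .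
      obtain j where j: "2 ^ j \<le> q" "q < 2 ^ (j + 1)" using ex_power_ivl1[of 2 q] q(1) by auto
      have jq: "2 ^ j \<le> real q" using j(1) by (metis of_nat_le_iff of_nat_numeral of_nat_power)
      have "y \<in> rational_points (2 ^ (j + 1))" using q j(2) by (auto simp: rational_points_iff)
      moreover have "norm (x - y) < \<rho> j"
      proof (rule power2_less_imp_less)
        have "(norm (x - y))\<^sup>2 \<le> C\<^sup>2 / (real q * real N)" by (fact q(4))
        also have "\<dots> \<le> C\<^sup>2 / (2 ^ j * real N)"
          using jq N0 q(1) by (intro divide_left_mono mult_right_mono) auto
        also have "\<dots> < (2 * C)\<^sup>2 / (2 ^ j * real N)"
          using C(1) N0 by (intro divide_strict_right_mono) (auto simp: power_mult_distrib)
        also have "\<dots> = (\<rho> j)\<^sup>2" using N0 by (simp add: \<rho>_def power_divide)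
        finally show "(norm (x - y))\<^sup>2 < (\<rho> j)\<^sup>2" .
      qed (use \<rho>0[of j] in simp)
      ultimately have "x \<in> V j" using nx by (auto simp: V_def cap_def)
      then show "x \<in> (\<Union>j\<in>{j. 2 ^ j \<le> Q N}. V j)" using order_trans[OF jq qQ] by blast
    qed
    have Vb: "measure sphere_measure (V j) \<le> D * real N powr (- real d / 2) * (2 ^ j) powr s" for j
    proof -
      have "measure sphere_measure (V j)
          \<le> (\<Sum>y\<in>rational_points (2 ^ (j + 1)). measure sphere_measure (cap (\<rho> j) (y :: real^'n)))"
        unfolding V_def by (intro measure_UNION_le finite_rational_points) auto
      also have "\<dots> = (\<Sum>y\<in>(rational_points (2 ^ (j + 1)) :: (real^'n) set). cap_mass TYPE('n) (\<rho> j))"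
        by (rule sum.cong) (auto simp: measure_cap rational_points_iff)
      also have "\<dots> = real (card (rational_points (2 ^ (j + 1)) :: (real^'n) set)) * cap_mass TYPE('n) (\<rho> j)"
        by simp
      also have "\<dots> \<le> (A * real (2 ^ (j + 1)) powr (real d + \<epsilon>)) * (B * \<rho> j ^ d)"
        by (intro mult_mono A(2) B(2) \<rho>0) (use A(1) in \<open>auto simp: cap_mass_def\<close>)
      also have "real (2 ^ (j + 1)) powr (real d + \<epsilon>) = 2 powr (real d + \<epsilon>) * (2 ^ j) powr (real d + \<epsilon>)"
        by (simp add: powr_mult)
      also have "\<rho> j ^ d = (2 * C) ^ d * ((2 ^ j) powr (- real d / 2) * real N powr (- real d / 2))"
      proof -
        have "sqrt (2 ^ j * real N) ^ d = ((2 ^ j * real N) powr (1/2)) powr real d"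
          using N0 by (simp add: powr_half_sqrt powr_realpow)
        also have "\<dots> = (2 ^ j) powr (real d / 2) * real N powr (real d / 2)"
          using N0 by (simp add: powr_powr powr_mult)
        finally have sq: "sqrt (2 ^ j * real N) ^ d = (2 ^ j) powr (real d / 2) * real N powr (real d / 2)" .
        have neg: "a powr (- real d / 2) = 1 / a powr (real d / 2)" for a :: real
          using powr_minus_divide[of a "real d / 2"] by simp
        show ?thesis unfolding \<rho>_def power_divide sq neg by simp
      qed
      also have "A * (2 powr (real d + \<epsilon>) * (2 ^ j) powr (real d + \<epsilon>)) *
          (B * ((2 * C) ^ d * ((2 ^ j) powr (- real d / 2) * real N powr (- real d / 2))))
         = D * real N powr (- real d / 2) * ((2 ^ j) powr (real d + \<epsilon>) * (2 ^ j) powr (- real d / 2))"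
        by (simp add: D_def mult_ac)
      also have "(2 ^ j :: real) powr (real d + \<epsilon>) * (2 ^ j) powr (- real d / 2) = (2 ^ j) powr s"
        by (simp add: s_def flip: powr_add)
      finally show ?thesis .
    qed
    have "measure sphere_measure (?U N) \<le> measure sphere_measure (\<Union>j\<in>{j. 2 ^ j \<le> Q N}. V j)"
      using sub Vm fin by (intro finite_measure_mono) (auto intro!: sets.finite_UN)
    also have "\<dots> \<le> (\<Sum>j | 2 ^ j \<le> Q N. measure sphere_measure (V j))"
      using fin Vm by (intro measure_UNION_le) auto
    also have "\<dots> \<le> (\<Sum>j | 2 ^ j \<le> Q N. D * real N powr (- real d / 2) * (2 ^ j) powr s)"
      by (rule sum_mono) (rule Vb)
    also have "\<dots> = D * real N powr (- real d / 2) * (\<Sum>j | 2 ^ j \<le> Q N. (2 ^ j) powr s)"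
      by (simp add: sum_distrib_left)
    also have "\<dots> \<le> D * real N powr (- real d / 2) * (2 * Q N powr s)"
      using sum_powers_of_2_le(2)[OF Q1 s1] D0 by (intro mult_left_mono) auto
    finally show ?thesis .
  qed
  define E where "E = 2 * D * (C\<^sup>2) powr s"
  \<comment> \<open>Minus the total exponent of \<open>N\<close>, namely of
    \<open>- d / 2 + (1 - 2 \<epsilon>) (d / 2 + \<epsilon>)\<close>.\<close>
  define \<kappa> where "\<kappa> = (real d - 1) * \<epsilon> + 2 * \<epsilon>\<^sup>2"
  have \<kappa>: "\<kappa> > 0" using d \<epsilon> by (simp add: \<kappa>_def add_nonneg_pos)
  have "D * real N powr (- real d / 2) * (2 * Q N powr s) = E * real N powr (- \<kappa>)" for N
  proof -
    have "real N powr (- real d / 2) * real N powr ((1 - 2 * \<epsilon>) * s) = real N powr (- \<kappa>)"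
      by (simp add: s_def \<kappa>_def algebra_simps power2_eq_square flip: powr_add)
    then show ?thesis using C(1) by (simp add: Q_def E_def powr_mult powr_powr mult_ac)
  qed
  then have ev: "eventually (\<lambda>N. measure sphere_measure (?U N) \<le> E * real N powr (- \<kappa>)) sequentially"
    using bound by (intro eventually_sequentiallyI[of "max 2 (nat \<lceil>C\<rceil>)"]) force
  have lim: "(\<lambda>N. E * real N powr (- \<kappa>)) \<longlonglongrightarrow> 0" using \<kappa> by real_asymp
  show ?thesis
    by (rule tendsto_sandwich[OF _ ev tendsto_const lim]) auto
qed

section \<open>The exponents\<close>

text \<open>Constants vanish on division by \<open>ln N\<close>, so bounds with arbitrarily small
  loss in the exponent determine the limit. The lower bound is asked only for
  \<open>\<eta> \<le> 1\<close> because the covering argument supplies only small losses.\<close>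

lemma ln_ratio_tendsto:
  fixes f :: "nat \<Rightarrow> real"
  assumes upper: "\<And>\<eta>. \<eta> > 0 \<Longrightarrow> \<exists>C>0. \<forall>\<^sub>F N in sequentially. f N \<le> C * real N powr (a + \<eta>)"
    and lower: "\<And>\<eta>. 0 < \<eta> \<Longrightarrow> \<eta> \<le> 1 \<Longrightarrow> \<exists>c>0. \<forall>\<^sub>F N in sequentially. c * real N powr (a - \<eta>) \<le> f N"
  shows "(\<lambda>N. ln (f N) / ln (real N)) \<longlonglongrightarrow> a"
proof (rule order_tendstoI)
  fix b assume b: "b < a"
  define \<eta> where "\<eta> = min 1 ((a - b) / 2)"
  have \<eta>: "0 < \<eta>" "\<eta> \<le> 1" "b < a - \<eta>" using b by (auto simp: \<eta>_def min_def field_simps)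
  obtain c where c: "c > 0" "\<forall>\<^sub>F N in sequentially. c * real N powr (a - \<eta>) \<le> f N" using lower \<eta> by blast
  have "(\<lambda>N. ln c / ln (real N)) \<longlonglongrightarrow> 0" by real_asymp
  then have "\<forall>\<^sub>F N in sequentially. ln c / ln (real N) > b - (a - \<eta>)"
    using \<eta>(3) by (intro order_tendstoD) auto
  then show "\<forall>\<^sub>F N in sequentially. b < ln (f N) / ln (real N)"
    using c(2) eventually_ge_at_top[of 2]
  proof eventually_elim
    case (elim N)
    have l: "ln (real N) > 0" using elim(3) by simp
    have "ln c + (a - \<eta>) * ln (real N) = ln (c * real N powr (a - \<eta>))"
      using c(1) elim(3) by (simp add: ln_mult ln_powr)
    also have "\<dots> \<le> ln (f N)" using elim(2,3) c(1) by (intro ln_mono) auto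
    finally have "(ln c + (a - \<eta>) * ln (real N)) / ln (real N) \<le> ln (f N) / ln (real N)"
      using l by (intro divide_right_mono) auto
    then have "ln c / ln (real N) + (a - \<eta>) \<le> ln (f N) / ln (real N)"
      using l by (simp add: add_divide_distrib)
    then show ?case using elim(1) by linarith
  qed
next
  fix b assume b: "a < b"
  define \<eta> where "\<eta> = (b - a) / 2"
  have \<eta>: "0 < \<eta>" "a + \<eta> < b" using b by (auto simp: \<eta>_def field_simps)
  obtain C where C: "C > 0" "\<forall>\<^sub>F N in sequentially. f N \<le> C * real N powr (a + \<eta>)" using upper \<eta> by blast
  \<comment> \<open>Any lower bound would do here: it makes \<open>f N\<close> positive, so that the
    logarithm is monotone.\<close>
  obtain c where c: "c > 0" "\<forall>\<^sub>F N in sequentially. c * real N powr (a - 1) \<le> f N" using lower[of 1] by auto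
  have "(\<lambda>N. ln C / ln (real N)) \<longlonglongrightarrow> 0" by real_asymp
  then have "\<forall>\<^sub>F N in sequentially. ln C / ln (real N) < b - (a + \<eta>)"
    using \<eta>(2) by (intro order_tendstoD) auto
  then show "\<forall>\<^sub>F N in sequentially. ln (f N) / ln (real N) < b"
    using C(2) c(2) eventually_ge_at_top[of 2]
  proof eventually_elim
    case (elim N)
    have l: "ln (real N) > 0" using elim(4) by simp
    have "c * real N powr (a - 1) > 0" using c(1) elim(4) by simp
    then have "f N > 0" using elim(3) by linarith
    then have "ln (f N) \<le> ln (C * real N powr (a + \<eta>))" using elim(2) by (intro ln_mono) auto
    also have "\<dots> = ln C + (a + \<eta>) * ln (real N)"
      using C(1) elim(4) by (simp add: ln_mult ln_powr)
    finally have "ln (f N) / ln (real N) \<le> (ln C + (a + \<eta>) * ln (real N)) / ln (real N)"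
      using l by (intro divide_right_mono) auto
    then have "ln (f N) / ln (real N) \<le> ln C / ln (real N) + (a + \<eta>)"
      using l by (simp add: add_divide_distrib)
    then show ?case using elim(1) by linarith
  qed
qed

lemma ln_ratio_tendsto_exact:
  fixes f :: "nat \<Rightarrow> real"
  assumes "c > 0" "C > 0"
    and "\<forall>\<^sub>F N in sequentially. c * real N powr a \<le> f N"
    and "\<forall>\<^sub>F N in sequentially. f N \<le> C * real N powr a"
  shows "(\<lambda>N. ln (f N) / ln (real N)) \<longlonglongrightarrow> a"
proof (rule ln_ratio_tendsto)
  fix \<eta> :: real assume \<eta>: "\<eta> > 0"
  have "\<forall>\<^sub>F N in sequentially. f N \<le> C * real N powr (a + \<eta>)"
    using assms(4) eventually_ge_at_top[of 1]
  proof eventually_elim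
    case (elim N)
    have "C * real N powr a \<le> C * real N powr (a + \<eta>)"
      using elim(2) \<eta> assms(2) by (intro mult_left_mono powr_mono) auto
    then show ?case using elim(1) by linarith
  qed
  then show "\<exists>C>0. \<forall>\<^sub>F N in sequentially. f N \<le> C * real N powr (a + \<eta>)" using assms(2) by blast
next
  fix \<eta> :: real assume \<eta>: "\<eta> > 0"
  have "\<forall>\<^sub>F N in sequentially. c * real N powr (a - \<eta>) \<le> f N"
    using assms(3) eventually_ge_at_top[of 1]
  proof eventually_elim
    case (elim N)
    have "c * real N powr (a - \<eta>) \<le> c * real N powr a"
      using elim(2) \<eta> assms(1) by (intro mult_left_mono powr_mono) auto
    then show ?case using elim(1) by linarith
  qed
  then show "\<exists>c>0. \<forall>\<^sub>F N in sequentially. c * real N powr (a - \<eta>) \<le> f N" using assms(1) by blast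
qed

lemma liminf_ln_quotient:
  fixes f g :: "nat \<Rightarrow> real"
  assumes "(\<lambda>N. ln (f N) / ln (real N)) \<longlonglongrightarrow> a" "(\<lambda>N. ln (g N) / ln (real N)) \<longlonglongrightarrow> b" "b \<noteq> 0"
  shows "liminf (\<lambda>N. ereal (ln (f N) / ln (g N))) = ereal (a / b)"
proof (rule lim_imp_Liminf)
  have "(\<lambda>N. (ln (f N) / ln (real N)) / (ln (g N) / ln (real N))) \<longlonglongrightarrow> a / b"
    using assms by (intro tendsto_divide)
  moreover have "\<forall>\<^sub>F N in sequentially. (ln (f N) / ln (real N)) / (ln (g N) / ln (real N)) = ln (f N) / ln (g N)"
    using eventually_ge_at_top[of 2] by eventually_elim simp
  ultimately show "(\<lambda>N. ereal (ln (f N) / ln (g N))) \<longlonglongrightarrow> ereal (a / b)"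
    by (intro tendsto_ereal) (rule Lim_transform_eventually)
qed simp

lemma cap_mass_tendsto:
  fixes r :: "nat \<Rightarrow> real"
  assumes n: "CARD('n::finite) = d + 1" and c: "c > 0" and C: "C > 0" and a: "a > 0"
    and r: "\<forall>\<^sub>F N in sequentially. c * real N powr (- a) \<le> r N"
           "\<forall>\<^sub>F N in sequentially. r N \<le> C * real N powr (- a)"
  shows "(\<lambda>N. ln (cap_mass TYPE('n) (r N)) / ln (real N)) \<longlonglongrightarrow> - (a * real d)"
proof -
  obtain A where A: "A > 0" "\<And>R. R > 0 \<Longrightarrow> cap_mass TYPE('n) R \<le> A * R ^ d"
    using cap_mass_upper[OF n] by blast
  obtain B where B: "B > 0" "\<And>R. 0 < R \<Longrightarrow> R \<le> 2 \<Longrightarrow> B * R ^ d \<le> cap_mass TYPE('n) R"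
    using cap_mass_lower[OF n] by blast
  have pw: "(real N powr (- a)) ^ d = real N powr (- (a * real d))" if "N \<ge> 1" for N
    using that by (simp add: powr_powr flip: powr_realpow)
  have "(\<lambda>N. C * real N powr (- a)) \<longlonglongrightarrow> 0" using a by real_asymp
  then have small: "\<forall>\<^sub>F N in sequentially. C * real N powr (- a) < 2" by (rule order_tendstoD) simp
  show ?thesis
  proof (rule ln_ratio_tendsto_exact)
    show "B * c ^ d > 0" "A * C ^ d > 0" using A B c C by auto
    show "\<forall>\<^sub>F N in sequentially. B * c ^ d * real N powr (- (a * real d)) \<le> cap_mass TYPE('n) (r N)"
      using r small eventually_ge_at_top[of 1]
    proof eventually_elim
      case (elim N)
      have p: "c * real N powr (- a) > 0" using c elim(4) by simp
      have "B * c ^ d * real N powr (- (a * real d)) = B * (c * real N powr (- a)) ^ d"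
        using pw[OF elim(4)] by (simp add: power_mult_distrib)
      also have "\<dots> \<le> B * r N ^ d" using elim(1) p B(1) by (intro mult_left_mono power_mono) auto
      also have "\<dots> \<le> cap_mass TYPE('n) (r N)" using elim p by (intro B(2)) auto
      finally show ?case .
    qed
    show "\<forall>\<^sub>F N in sequentially. cap_mass TYPE('n) (r N) \<le> A * C ^ d * real N powr (- (a * real d))"
      using r eventually_ge_at_top[of 1]
    proof eventually_elim
      case (elim N)
      have p: "c * real N powr (- a) > 0" using c elim(3) by simp
      have "cap_mass TYPE('n) (r N) \<le> A * r N ^ d" using elim(1) p by (intro A(2)) auto
      also have "\<dots> \<le> A * (C * real N powr (- a)) ^ d"
        using elim p A(1) by (intro mult_left_mono power_mono) auto
      also have "\<dots> = A * C ^ d * real N powr (- (a * real d))"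
        using pw[OF elim(3)] by (simp add: power_mult_distrib)
      finally show ?case .
    qed
  qed
qed

text \<open>Admissible radii must lie strictly between 0 and 2 for every index, but the power is 0
  at \<open>N = 0\<close>; hence the default value 1.\<close>

lemma generic_radius_bounds:
  assumes \<epsilon>: "0 < \<epsilon>" "\<epsilon> \<le> 1/2" and r: "r = (\<lambda>N. if N < 2 then 1 else real N powr (\<epsilon> - 1))"
  shows "0 < r N" "r N < 2"
proof -
  have "real N powr (\<epsilon> - 1) \<le> 1" if "N \<ge> 2" using powr_mono[of "\<epsilon> - 1" 0 "real N"] that \<epsilon> by simp
  then show "0 < r N" "r N < 2" by (auto simp: r)
qed

text \<open>The lower bound constructs no points: caps of radius
  \<open>N powr (\<epsilon> - 1)\<close> eventually cover more than half of the sphere, which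
  requires at least a constant times \<open>N powr (d (1 - \<epsilon>))\<close> of them. The choice
  \<open>\<epsilon> = \<eta> / d\<close> turns this exponent into \<open>d - \<eta>\<close>.\<close>

lemma card_rational_points_tendsto:
  assumes n: "CARD('n::finite) = d + 1" and d: "d \<ge> 2"
  shows "(\<lambda>N. ln (real (card (rational_points N :: (real^'n) set))) / ln (real N)) \<longlonglongrightarrow> real d"
proof (rule ln_ratio_tendsto)
  fix \<eta> :: real assume "\<eta> > 0"
  from card_rational_points_le[OF n this] obtain C where C: "C > 0"
    "\<And>T. T \<ge> 1 \<Longrightarrow> real (card (rational_points T :: (real^'n) set)) \<le> C * real T powr (real d + \<eta>)"
    by blast
  then show "\<exists>C>0. \<forall>\<^sub>F N in sequentially. real (card (rational_points N :: (real^'n) set)) \<le> C * real N powr (real d + \<eta>)"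
    by (intro exI[of _ C]) (auto simp: eventually_sequentially)
next
  fix \<eta> :: real assume \<eta>: "0 < \<eta>" "\<eta> \<le> 1"
  define \<epsilon> where "\<epsilon> = \<eta> / real d"
  have "\<eta> / real d \<le> 1 / 2" using \<eta> d by (intro frac_le) auto
  then have \<epsilon>: "0 < \<epsilon>" "\<epsilon> \<le> 1/2" using \<eta> d by (simp_all add: \<epsilon>_def)
  define r where "r = (\<lambda>N. if N < 2 then 1 else real N powr (\<epsilon> - 1))"
  obtain A where A: "A > 0" "\<And>R. R > 0 \<Longrightarrow> cap_mass TYPE('n) R \<le> A * R ^ d"
    using cap_mass_upper[OF n] by blast
  let ?U = "\<lambda>N. sphere 0 1 - (\<Union>x\<in>rational_points N. cap (r N) x :: (real^'n) set)"
  have "(\<lambda>N. measure sphere_measure (?U N)) \<longlonglongrightarrow> 0"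
    by (rule generic_covering_rational_points[OF n d \<epsilon>]) (simp add: r_def)
  then have "\<forall>\<^sub>F N in sequentially. measure sphere_measure (?U N) < 1/2" by (rule order_tendstoD) simp
  then have "\<forall>\<^sub>F N in sequentially. 1 / (2 * A) * real N powr (real d - \<eta>) \<le> real (card (rational_points N :: (real^'n) set))"
    using eventually_ge_at_top[of 2]
  proof eventually_elim
    case (elim N)
    let ?X = "rational_points N :: (real^'n) set"
    have X: "?X \<subseteq> sphere 0 1" by (auto simp: rational_points_iff)
    have rN: "r N ^ d = real N powr (- (real d - \<eta>))"
    proof -
      have "(\<epsilon> - 1) * real d = - (real d - \<eta>)" using d by (simp add: \<epsilon>_def field_simps)
      then show ?thesis using elim(2) by (simp add: r_def powr_powr flip: powr_realpow)
    qed
    have "1 / 2 \<le> real (card ?X) * cap_mass TYPE('n) (r N)"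
      using one_minus_uncovered_le[OF finite_rational_points X, of "r N"] elim(1) by linarith
    also have "\<dots> \<le> real (card ?X) * (A * r N ^ d)"
      using generic_radius_bounds(1)[OF \<epsilon> r_def] by (intro mult_left_mono A(2)) auto
    finally have "1 / 2 \<le> real (card ?X) * A / real N powr (real d - \<eta>)"
      unfolding rN powr_minus_divide by simp
    then show ?case using A(1) elim(2) by (simp add: field_simps)
  qed
  then show "\<exists>c>0. \<forall>\<^sub>F N in sequentially. c * real N powr (real d - \<eta>) \<le> real (card (rational_points N :: (real^'n) set))"
    using A(1) by (intro exI[of _ "1 / (2 * A)"]) auto
qed

text \<open>Once half of the sphere is covered, the number of points times the cap mass is at least
  1/2. With \<open>L\<close> and \<open>l\<close> as below this reads
  \<open>l - ln 2 \<le> L\<close>, and the constant \<open>ln 2\<close> is absorbed because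
  \<open>L\<close> tends to infinity.\<close>

lemma generic_liminf_le:
  fixes X :: "nat \<Rightarrow> (real^'n) set"
  assumes n: "CARD('n) = d + 1"
    and X: "\<And>N. finite (X N)" "\<And>N. X N \<subseteq> sphere 0 1"
    and card: "filterlim (\<lambda>N. ln (real (card (X N)))) at_top sequentially"
    and R: "\<And>N. 0 < R N" "\<And>N. R N < 2"
    and cov: "(\<lambda>N. measure sphere_measure (sphere 0 1 - (\<Union>x\<in>X N. cap (R N) x))) \<longlonglongrightarrow> 0"
    and \<eta>: "\<eta> > 0"
  shows "liminf (\<lambda>N. ereal (ln (real (card (X N))) / ln (cap_mass TYPE('n) (R N)))) \<le> ereal (- (1 - \<eta>))"
proof (rule Liminf_le)
  obtain B where B: "B > 0" "\<And>R. 0 < R \<Longrightarrow> R \<le> 2 \<Longrightarrow> B * R ^ d \<le> cap_mass TYPE('n) R"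
    using cap_mass_lower[OF n] by blast
  have pos: "cap_mass TYPE('n) (R N) > 0" for N
  proof -
    have "B * R N ^ d > 0" using B(1) R(1) by simp
    also have "\<dots> \<le> cap_mass TYPE('n) (R N)" using R[of N] by (intro B(2)) auto
    finally show ?thesis .
  qed
  have "\<forall>\<^sub>F N in sequentially. measure sphere_measure (sphere 0 1 - (\<Union>x\<in>X N. cap (R N) x)) < 1/2"
    using cov by (rule order_tendstoD) simp
  moreover have "\<forall>\<^sub>F N in sequentially. ln (real (card (X N))) > max 0 (ln 2 / \<eta>)"
    using card by (simp only: filterlim_at_top_dense)
  ultimately show "\<forall>\<^sub>F N in sequentially. ereal (ln (real (card (X N))) / ln (cap_mass TYPE('n) (R N))) \<le> ereal (- (1 - \<eta>))"
  proof eventually_elim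
    case (elim N)
    define L where "L = ln (real (card (X N)))"
    define l where "l = - ln (cap_mass TYPE('n) (R N))"
    have l0: "l > 0" using pos[of N] cap_mass_less_1[OF R(1)[of N] R(2)[of N], where 'n='n] by (simp add: l_def)
    have L: "L > 0" "L > ln 2 / \<eta>" using elim(2) by (auto simp: L_def)
    have c0: "real (card (X N)) > 0" using L(1) by (cases "card (X N)") (auto simp: L_def)
    have "1 / 2 \<le> real (card (X N)) * cap_mass TYPE('n) (R N)"
      using one_minus_uncovered_le[OF X(1)[of N] X(2)[of N], of "R N"] elim(1) by linarith
    then have "ln (1 / 2) \<le> ln (real (card (X N)) * cap_mass TYPE('n) (R N))"
      by (intro ln_mono) auto
    then have Ll: "l - ln 2 \<le> L"
      using c0 pos[of N] by (simp add: ln_mult ln_div L_def l_def)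
    have "(1 - \<eta>) * l \<le> L"
    \<comment> \<open>If \<open>L < (1 - \<eta>) l\<close>, then \<open>\<eta> l < ln 2\<close>, so
      \<open>L < l < ln 2 / \<eta>\<close>, against the choice of \<open>N\<close>.\<close>
    proof (rule ccontr)
      assume "\<not> ?thesis"
      then have *: "L < (1 - \<eta>) * l" by simp
      then have "\<eta> * l < ln 2" using Ll by (simp add: algebra_simps)
      then have "l < ln 2 / \<eta>" using \<eta> by (simp add: field_simps)
      moreover have "(1 - \<eta>) * l \<le> l" using \<eta> l0 by simp
      ultimately show False using * L(2) by linarith
    qed
    then have "1 - \<eta> \<le> L / l" using l0 by (simp add: field_simps)
    moreover have "ln (real (card (X N))) / ln (cap_mass TYPE('n) (R N)) = - (L / l)"
      by (simp add: L_def l_def)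
    ultimately show ?case by simp
  qed
qed simp

theorem proposition1p10:
  fixes d :: nat
  assumes "d \<ge> 2" and "CARD('n::finite) = d + 1"
  shows "covering_exponent (rational_points :: nat \<Rightarrow> (real^'n) set) = 2 \<and>
         generic_covering_exponent (rational_points :: nat \<Rightarrow> (real^'n) set) = 1"
proof
  note d = assms(1) and n = assms(2)
  let ?X = "rational_points :: nat \<Rightarrow> (real^'n) set"
  have card: "(\<lambda>N. ln (real (card (?X N))) / ln (real N)) \<longlonglongrightarrow> real d"
    by (rule card_rational_points_tendsto[OF n d])
  have "CARD('n) \<ge> 2" using n d by simp
  from covering_radius_rational_points[OF this] obtain C where C: "C \<ge> 1" "\<And>N. real N \<ge> C \<Longrightarrow>
      1 / sqrt (2 * real N) \<le> covering_radius (?X N) \<and> covering_radius (?X N) \<le> C / sqrt (real N)"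
    by blast
  have ev: "\<forall>\<^sub>F N in sequentially. real N \<ge> C"
    using filterlim_real_sequentially by (simp add: filterlim_at_top)
  have sq: "real N powr (- (1/2)) = 1 / sqrt (real N)" for N
    by (simp add: powr_minus_divide powr_half_sqrt)
  \<comment> \<open>Radii of order \<open>N powr (-1/2)\<close> give mass exponent
    \<open>- d / 2\<close>; against the exponent \<open>d\<close> of the number of points the
    quotient is -2.\<close>
  have "(\<lambda>N. ln (cap_mass TYPE('n) (covering_radius (?X N))) / ln (real N)) \<longlonglongrightarrow> - (1/2 * real d)"
  proof (rule cap_mass_tendsto[OF n])
    show "\<forall>\<^sub>F N in sequentially. 1 / sqrt 2 * real N powr (- (1/2)) \<le> covering_radius (?X N)"
      using ev by eventually_elim (use C(2) in \<open>simp add: sq real_sqrt_mult\<close>)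
    show "\<forall>\<^sub>F N in sequentially. covering_radius (?X N) \<le> C * real N powr (- (1/2))"
      using ev by eventually_elim (use C(2) in \<open>simp add: sq\<close>)
  qed (use C(1) in auto)
  from liminf_ln_quotient[OF card this]
  have "liminf (\<lambda>N. ereal (ln (real (card (?X N))) / ln (cap_mass TYPE('n) (covering_radius (?X N))))) = ereal (-2)"
    using d by simp
  then show "covering_exponent ?X = 2" unfolding covering_exponent_def by simp

  let ?V = "\<lambda>R. - liminf (\<lambda>N. ereal (ln (real (card (?X N))) / ln (cap_mass TYPE('n) (R N))))"
  let ?\<R> = "{R :: nat \<Rightarrow> real. (\<forall>N. 0 < R N \<and> R N < 2) \<and>
          (\<lambda>N. measure sphere_measure (sphere 0 1 - (\<Union>x\<in>?X N. cap (R N) x))) \<longlonglongrightarrow> 0}"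
  have "(INF R\<in>?\<R>. ?V R) = 1"
  proof (rule antisym)
    show "(INF R\<in>?\<R>. ?V R) \<le> 1"
    proof (rule ereal_le_epsilon2)
      fix e :: real assume e: "e > 0"
      \<comment> \<open>The value \<open>e / (1 + e)\<close> solves
        \<open>1 / (1 - \<epsilon>) = 1 + e\<close>; the minimum keeps \<open>\<epsilon>\<close> in
        the range of the covering result.\<close>
      define \<epsilon> where "\<epsilon> = min (1/2) (e / (1 + e))"
      have \<epsilon>e: "\<epsilon> \<le> e / (1 + e)" unfolding \<epsilon>_def by (rule min.cobounded2)
      have "\<epsilon> > 0" using e by (simp add: \<epsilon>_def)
      moreover have "\<epsilon> \<le> 1/2" unfolding \<epsilon>_def by (rule min.cobounded1)
      ultimately have \<epsilon>: "0 < \<epsilon>" "\<epsilon> \<le> 1/2" by auto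
      define r where "r = (\<lambda>N. if N < 2 then 1 else real N powr (\<epsilon> - 1))"
      have "r \<in> ?\<R>"
        using generic_radius_bounds[OF \<epsilon> r_def] generic_covering_rational_points[OF n d \<epsilon>, of r]
        by (simp add: r_def)
      then have "(INF R\<in>?\<R>. ?V R) \<le> ?V r" by (rule INF_lower)
      also have "(\<lambda>N. ln (cap_mass TYPE('n) (r N)) / ln (real N)) \<longlonglongrightarrow> - ((1 - \<epsilon>) * real d)"
      proof (rule cap_mass_tendsto[OF n])
        show "\<forall>\<^sub>F N in sequentially. 1 * real N powr - (1 - \<epsilon>) \<le> r N"
          "\<forall>\<^sub>F N in sequentially. r N \<le> 1 * real N powr - (1 - \<epsilon>)"
          by (auto simp: r_def intro!: eventually_sequentiallyI[of 2])
      qed (use \<epsilon> in auto)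
      then have "?V r = ereal (1 / (1 - \<epsilon>))"
        using liminf_ln_quotient[OF card] d \<epsilon> by simp
      also have "1 / (1 - \<epsilon>) \<le> 1 + e"
      proof -
        have "(1 + e) * \<epsilon> \<le> (1 + e) * (e / (1 + e))" using e \<epsilon>e by (intro mult_left_mono) auto
        then have "(1 + e) * \<epsilon> \<le> e" using e by simp
        then show ?thesis using \<epsilon> by (simp add: field_simps)
      qed
      finally show "(INF R\<in>?\<R>. ?V R) \<le> 1 + ereal e" by (simp add: add.commute)
    qed
  next
    show "1 \<le> (INF R\<in>?\<R>. ?V R)"
    proof (rule INF_greatest)
      fix R assume R: "R \<in> ?\<R>"
      have "filterlim (\<lambda>N. ln (real (card (?X N)))) at_top sequentially"
      proof -
        have lim: "filterlim (\<lambda>N. ln (real (card (?X N))) / ln (real N) * ln (real N)) at_top sequentially"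
        proof (rule filterlim_tendsto_pos_mult_at_top[OF card])
          show "filterlim (\<lambda>N. ln (real N)) at_top sequentially" by real_asymp
        qed (use d in simp)
        have "\<forall>\<^sub>F N in sequentially. ln (real (card (?X N))) / ln (real N) * ln (real N) = ln (real (card (?X N)))"
          using eventually_ge_at_top[of 2] by eventually_elim simp
        from filterlim_cong[OF refl refl this] lim show ?thesis by (rule iffD1)
      qed
      note lim = generic_liminf_le[OF n finite_rational_points _ this, of R]
      have X: "?X N \<subseteq> sphere 0 1" for N by (auto simp: rational_points_iff)
      have le: "liminf (\<lambda>N. ereal (ln (real (card (?X N))) / ln (cap_mass TYPE('n) (R N)))) \<le> ereal (- (1 - \<eta>))"
        if "\<eta> > 0" for \<eta>
        using lim[OF X _ _ _ that] R by simp
      show "1 \<le> ?V R"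
      proof (rule ereal_le_epsilon2)
        fix \<eta> :: real assume "\<eta> > 0"
        from le[OF this] have "- ereal (- (1 - \<eta>)) \<le> ?V R" by (simp only: ereal_minus_le_minus)
        then have "ereal (1 - \<eta>) + ereal \<eta> \<le> ?V R + ereal \<eta>" by (intro add_right_mono) simp
        then show "1 \<le> ?V R + ereal \<eta>" by (simp add: one_ereal_def)
      qed
    qed
  qed
  then show "generic_covering_exponent ?X = 1" by (simp add: generic_covering_exponent_def)
qed

end
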